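(* Let $(X_t)_{t\ge 0}$ be a discrete time Markov chain on $\mathcal{X}$ with transition kernel $P$. Assume that $(X_t)$ is reversible with respect to the probability measure $\pi$ on $\mathcal{X}$ and that it has nonnegative eigenvalues. Suppose that $T$ is a strong random time for $(X_t)$ with measure $\nu$ such that $\mathbf{P}_\nu(T \geq 1) = 1$ and $\mathbf{E}_\nu[T] < \infty$, and that $\mathbf{P}_\mu(T < \infty) = 1$ for all probability measures $\mu$ on $\mathcal{X}$. Fix $x\in\mathcal{X}$ and suppose that there are constants $A(\nu),A(x)<\infty$ and $0<\rho<1$ such that $\mathbf{P}_\nu(T>t)\le A(\nu)\rho^t$ and $\mathbf{P}_x(T>t)\le A(x)\rho^t$ for all integers $t\ge 0$. Set \[ D = \frac{1}{2}\sqrt{\frac{A(\nu)\rho}{1-\rho}}, \qquad F(x,t) = \frac{1-\rho}{\rho}\, D\,A(x)\, t + (1-D)_+ A(x) + D . \] Then \[ \|P^t(x,\cdot)-\pi\|_{\mathrm{TV}} \le F(x,t)\,\rho^t \qquad \text{for all integers } t\ge 0 . \]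
   Context: $\mathcal{X}$ is a general (measurable) state space; all subsets $S\subset\mathcal{X}$ and all functions considered are measurable. For a probability measure $\mu$ on $\mathcal{X}$, $\mathbf{P}_\mu$ and $\mathbf{E}_\mu$ denote probability and expectation for the chain $(X_t)$ (together with the random time $T$) started from $X_0\sim\mu$; $\mathbf{P}_x$ is the case $X_0=x$. $P^t(x,\cdot)$ is the law of the chain started from $x$ after $t$ steps. For $r\in\mathbb{R}$, $r_+=\max(r,0)$. Total variation distance: $\|\mu-\mu'\|_{\mathrm{TV}}=\sup_{S\subset\mathcal{X}}|\mu(S)-\mu'(S)|$ for probability measures $\mu,\mu'$. Randomized stopping time: a random time $T$ with values in $\{0,1,2,\dots\}\cup\{\infty\}$ such that for each $n\ge 0$, given $(X_0,\ldots,X_n)$, the event $\{T=n\}$ and the future trajectory $(X_{n+1},X_{n+2},\ldots)$ are conditionally independent (so $\{T=n\}$ may depend on the history $(X_0,\dots,X_n)$ and on additional randomness that plays no role in the trajectory of the chain after time $n$). Strong random time: for a fixed probability measure $\nu$ on $\mathcal{X}$, a strong random time for $(X_t)$ with measure $\nu$ is a randomized stopping time $T$ such that for every probability measure $\mu$ on $\mathcal{X}$, $\mathbf{P}_\mu(X_n\in S\mid T=n)=\nu(S)$ for all $n\ge 0$ and $S\subset\mathcal{X}$ (the equality is considered trivially satisfied when $\mathbf{P}_\mu(T=n)=0$). Reversibility: $(X_t)$ is reversible with respect to $\pi$ if $\pi(dx)P(x,dy)=\pi(dy)P(y,dx)$ as measures on $\mathcal{X}\times\mathcal{X}$; equivalently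 $f\mapsto Pf$, $Pf(x)=\int f(y)P(x,dy)$, is a self-adjoint operator on the space $L^2(\pi)$ of real-valued functions. Its spectrum is then contained in $[-1,1]$; the chain has nonnegative eigenvalues if the $L^2(\pi)$ spectrum of $P$ is contained in $[0,1]$. *)

theory Defs
  imports "HOL-Probability.Probability"
begin

text \<open>
  A general state space is a measurable space \<open>M\<close>, a transition kernel is a measurable map
  \<open>P \<in> M \<rightarrow>\<^sub>M prob_algebra M\<close>, and the probability measures on the state space are the
  elements of \<open>space (prob_algebra M)\<close>.  The chain \<open>X\<close> and the random time \<open>T\<close> are random
  variables on one measurable space \<open>\<Omega>\<close>, which carries a probability measure \<open>Pr \<mu>\<close> for every
  initial distribution \<open>\<mu>\<close>; the case of a deterministic start \<open>x\<close> is \<open>Pr (return M x)\<close>.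
\<close>

definition tv_dist :: "'a measure \<Rightarrow> 'a measure \<Rightarrow> real" where
  "tv_dist \<mu> \<mu>' = (SUP S\<in>sets \<mu>. \<bar>measure \<mu> S - measure \<mu>' S\<bar>)"

text \<open>The \<open>\<sigma>\<close>-algebra on \<open>\<Omega>\<close> generated by \<open>(X\<^sub>0, \<dots>, X\<^sub>n)\<close>:\<close>

definition history :: "'w measure \<Rightarrow> 'a measure \<Rightarrow> (nat \<Rightarrow> 'w \<Rightarrow> 'a) \<Rightarrow> nat \<Rightarrow> 'w measure" where
  "history N M X n =
     vimage_algebra (space N) (\<lambda>\<omega>. \<lambda>i\<in>{..n}. X i \<omega>) (PiM {..n} (\<lambda>_. M))"

text \<open>Conditional probability of an event given a sub-\<open>\<sigma>\<close>-algebra \<open>F\<close>, as a random variable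
  (defined up to null sets):\<close>

definition cond_prob_given :: "'w measure \<Rightarrow> 'w measure \<Rightarrow> 'w set \<Rightarrow> 'w \<Rightarrow> real" where
  "cond_prob_given N F A = real_cond_exp N F (indicator A)"

definition markov_chain ::
  "'w measure \<Rightarrow> 'a measure \<Rightarrow> ('a \<Rightarrow> 'a measure) \<Rightarrow> 'a measure \<Rightarrow> (nat \<Rightarrow> 'w \<Rightarrow> 'a) \<Rightarrow> bool" where
  "markov_chain N M P \<mu> X \<longleftrightarrow>
     prob_space N \<and> (\<forall>n. X n \<in> N \<rightarrow>\<^sub>M M) \<and> distr N M (X 0) = \<mu> \<and>
     (\<forall>n. \<forall>S\<in>sets M. AE \<omega> in N.
        cond_prob_given N (history N M X n) {\<omega> \<in> space N. X (Suc n) \<omega> \<in> S} \<omega>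
          = measure (P (X n \<omega>)) S)"

definition cond_indep_events :: "'w measure \<Rightarrow> 'w measure \<Rightarrow> 'w set \<Rightarrow> 'w set \<Rightarrow> bool" where
  "cond_indep_events N F A B \<longleftrightarrow>
     (AE \<omega> in N. cond_prob_given N F (A \<inter> B) \<omega>
        = cond_prob_given N F A \<omega> * cond_prob_given N F B \<omega>)"

definition randomized_stopping_time ::
  "'w measure \<Rightarrow> 'a measure \<Rightarrow> (nat \<Rightarrow> 'w \<Rightarrow> 'a) \<Rightarrow> ('w \<Rightarrow> enat) \<Rightarrow> bool" where
  "randomized_stopping_time N M X T \<longleftrightarrow>
     T \<in> N \<rightarrow>\<^sub>M count_space UNIV \<and>
     (\<forall>n. \<forall>B\<in>sets (PiM UNIV (\<lambda>_. M)).
        cond_indep_events N (history N M X n)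
          {\<omega> \<in> space N. T \<omega> = enat n}
          {\<omega> \<in> space N. (\<lambda>i. X (Suc n + i) \<omega>) \<in> B})"

definition strong_random_time ::
  "('a measure \<Rightarrow> 'w measure) \<Rightarrow> 'a measure \<Rightarrow> (nat \<Rightarrow> 'w \<Rightarrow> 'a) \<Rightarrow> ('w \<Rightarrow> enat) \<Rightarrow> 'a measure \<Rightarrow> bool"
where
  "strong_random_time Pr M X T \<nu> \<longleftrightarrow>
     \<nu> \<in> space (prob_algebra M) \<and>
     (\<forall>\<mu>\<in>space (prob_algebra M).
        randomized_stopping_time (Pr \<mu>) M X T \<and>
        (\<forall>n. \<forall>S\<in>sets M. \<P>(\<omega> in Pr \<mu>. T \<omega> = enat n) \<noteq> 0 \<longrightarrow>
           \<P>(\<omega> in Pr \<mu>. X n \<omega> \<in> S \<bar> T \<omega> = enat n) = measure \<nu> S))"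

text \<open>The two sides are \<open>\<pi>(dx)P(x,dy)\<close> and \<open>\<pi>(dy)P(y,dx)\<close> as measures in \<open>(x,y)\<close>.\<close>

definition reversible_wrt :: "'a measure \<Rightarrow> ('a \<Rightarrow> 'a measure) \<Rightarrow> 'a measure \<Rightarrow> bool" where
  "reversible_wrt M P \<pi> \<longleftrightarrow>
     \<pi> \<bind> (\<lambda>x. distr (P x) (M \<Otimes>\<^sub>M M) (\<lambda>y. (x, y))) =
     \<pi> \<bind> (\<lambda>y. distr (P y) (M \<Otimes>\<^sub>M M) (\<lambda>x. (x, y)))"

text \<open>The real space \<open>L\<^sup>2(\<pi>)\<close> is represented by square integrable functions, with equality
  \<open>\<pi>\<close>-almost everywhere in place of equality.\<close>

definition L2_fun :: "'a measure \<Rightarrow> ('a \<Rightarrow> real) set" where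
  "L2_fun \<pi> = {f \<in> borel_measurable \<pi>. integrable \<pi> (\<lambda>x. (f x)\<^sup>2)}"

definition L2_norm_fun :: "'a measure \<Rightarrow> ('a \<Rightarrow> real) \<Rightarrow> real" where
  "L2_norm_fun \<pi> f = sqrt (\<integral>x. (f x)\<^sup>2 \<partial>\<pi>)"

definition kernel_op :: "('a \<Rightarrow> 'a measure) \<Rightarrow> ('a \<Rightarrow> real) \<Rightarrow> 'a \<Rightarrow> real" where
  "kernel_op P f x = (\<integral>y. f y \<partial>P x)"

text \<open>The resolvent set consists of the \<open>r\<close> for which \<open>U - r I\<close> is a bijection of \<open>L\<^sup>2(\<pi>)\<close> with
  bounded inverse: each \<open>g\<close> has a preimage of norm at most \<open>C \<parallel>g\<parallel>\<close>, and this is the only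
  preimage.  Only real \<open>r\<close> are considered, as \<open>L\<^sup>2(\<pi>)\<close> is real and \<open>U\<close> is meant to be self-adjoint.\<close>

definition L2_resolvent_set :: "'a measure \<Rightarrow> (('a \<Rightarrow> real) \<Rightarrow> 'a \<Rightarrow> real) \<Rightarrow> real set" where
  "L2_resolvent_set \<pi> U =
     {r. \<exists>C. \<forall>g\<in>L2_fun \<pi>. \<exists>f\<in>L2_fun \<pi>.
           (AE x in \<pi>. U f x - r * f x = g x) \<and>
           L2_norm_fun \<pi> f \<le> C * L2_norm_fun \<pi> g \<and>
           (\<forall>f'\<in>L2_fun \<pi>. (AE x in \<pi>. U f' x - r * f' x = g x) \<longrightarrow> (AE x in \<pi>. f' x = f x))}"

definition L2_spectrum :: "'a measure \<Rightarrow> (('a \<Rightarrow> real) \<Rightarrow> 'a \<Rightarrow> real) \<Rightarrow> real set" where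
  "L2_spectrum \<pi> U = - L2_resolvent_set \<pi> U"

definition nonneg_eigenvalues :: "('a \<Rightarrow> 'a measure) \<Rightarrow> 'a measure \<Rightarrow> bool" where
  "nonneg_eigenvalues P \<pi> \<longleftrightarrow> L2_spectrum \<pi> (kernel_op P) \<subseteq> {0..1}"

end

theory Submission
  imports Defs "HOL-Computational_Algebra.Formal_Power_Series"
begin

text \<open>
  Write \<open>G k\<close> for the probability that \<open>T\<close> exceeds \<open>k\<close> for the chain started from \<open>\<nu>\<close>, and \<open>m\<close> for
  the sum of all \<open>G k\<close>, which is the mean of \<open>T\<close>.  The proof combines renewal theory for \<open>T\<close> with the
  spectral theory of \<open>P\<close> on \<open>L\<^sup>2(\<pi>)\<close>.

  At the time \<open>T\<close> the chain restarts from \<open>\<nu>\<close>.  So for every initial law \<open>\<mu>\<close> the law at time \<open>t\<close> is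
  the part living on \<open>T > t\<close> plus the mixture of \<open>\<nu>P\<^bsup>t-n\<^esup>\<close> with the weights of \<open>T = n\<close>
  (\<open>strong_time_decomposition\<close>).  Use this for two initial laws.  Started from \<open>\<nu>\<close>, it is a renewal equation and says
  that \<open>w\<^sub>n = \<Sum>\<^bsub>k\<le>n\<^esub> G k \<cdot> \<nu>P\<^bsup>n-k\<^esup>\<close> increases with \<open>n\<close>.  Started from \<open>\<pi>\<close>, whose law does not move, it
  bounds the mixtures of the \<open>\<nu>P\<^sup>j\<close> by \<open>\<pi>\<close>; convolved with \<open>G\<close> it yields \<open>w\<^sub>n \<le> m\<pi>\<close>
  (\<open>renewal_sum_le\<close>).

  The case \<open>n = 0\<close> gives \<open>\<nu>\<close> a density \<open>f\<close> with respect to \<open>\<pi>\<close> that is bounded by \<open>m\<close>, and by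
  reversibility \<open>P\<^sup>nf\<close> is the density of \<open>\<nu>P\<^sup>n\<close>.  Let \<open>u n = \<langle>f, P\<^sup>nf\<rangle>\<close>.  Nonnegative eigenvalues make
  \<open>u\<close> decrease (\<open>autocorrelation_decreasing\<close>), so integrating \<open>f\<close> against \<open>w\<^sub>n \<le> m\<pi>\<close> gives
  \<open>u n \<cdot> \<Sum>\<^bsub>k\<le>n\<^esub> G k \<le> m\<close>; as \<open>u n \<le> m\<close>, the excess \<open>u n - 1\<close> is at most the tail \<open>\<Sum>\<^bsub>k>n\<^esub> G k\<close>.  For
  \<open>n = 2t\<close> this excess is the squared \<open>L\<^sup>2(\<pi>)\<close> distance of \<open>P\<^sup>tf\<close> from \<open>1\<close>, and Cauchy-Schwarz bounds
  the total variation distance of \<open>\<nu>P\<^sup>t\<close> from \<open>\<pi>\<close> by half of its root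
  (\<open>total_variation_from_dominating_sums\<close>).  With geometric tails this bound is \<open>D \<rho>\<^sup>t\<close>.

  Finally the decomposition for the chain started from \<open>x\<close> averages these bounds over \<open>T\<close>, and a
  summation by parts turns the average into \<open>F(x,t) \<rho>\<^sup>t\<close> (\<open>convolution_geometric_bound\<close>).
\<close>

section \<open>Renewal equations\<close>

text \<open>
  Here \<open>q\<close> and \<open>p\<close> are the laws of the renewal time for the chain started from \<open>\<nu>\<close> and from \<open>\<pi>\<close>, \<open>G\<close> is the
  tail of \<open>q\<close>, \<open>v t\<close> is the mass that \<open>\<nu>P\<^sup>t\<close> gives to a fixed set, and \<open>c\<close> is the mass of that set
  under \<open>\<pi>\<close>.  In terms of generating functions \<open>q = 1 - (1 - X) G\<close>, so the renewal inequality
  \<open>q v \<le> v\<close> says that the coefficients \<open>w\<close> of \<open>G v\<close> increase.  Convolving the delayed inequality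
  \<open>p v \<le> c\<close> with \<open>G\<close> bounds the coefficients of \<open>p (G v)\<close> by \<open>m c\<close>.  Since \<open>p\<close> has total mass one and
  \<open>w\<close> increases, the late coefficients of \<open>p w\<close> eventually dominate any fixed \<open>w j\<close>.
\<close>

lemma renewal_sum_le:
  fixes G q v p :: "nat \<Rightarrow> real"
  assumes v: "\<And>t. 0 \<le> v t" and p: "\<And>n. 0 \<le> p n" "p sums 1"
    and G: "\<And>n. 0 \<le> G n" "G sums m" "G 0 = 1"
    and q: "q 0 = 0" "\<And>n. q (Suc n) = G n - G (Suc n)"
    and renewal: "\<And>t. (\<Sum>n\<le>t. q n * v (t - n)) \<le> v t"
    and delayed: "\<And>t. (\<Sum>n\<le>t. p n * v (t - n)) \<le> c"
    and c: "0 \<le> c"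
  shows "(\<Sum>k\<le>j. G k * v (j - k)) \<le> m * c"
proof -
  define w where "w j = (\<Sum>k\<le>j. G k * v (j - k))" for j
  let ?G = "Abs_fps G" and ?v = "Abs_fps v" and ?p = "Abs_fps p" and ?q = "Abs_fps q"
  have w: "Abs_fps w = ?G * ?v"
    by (simp add: fps_eq_iff fps_mult_nth w_def atMost_atLeast0)
  have "?q = 1 - (1 - fps_X) * ?G"
  proof (rule fps_ext)
    show "fps_nth ?q n = fps_nth (1 - (1 - fps_X) * ?G) n" for n
      using G(3) q by (cases n) (simp_all add: left_diff_distrib)
  qed
  then have "(1 - fps_X) * Abs_fps w = ?v - ?q * ?v"
    unfolding w by (simp only:) (simp add: algebra_simps)
  then have "fps_nth ((1 - fps_X) * Abs_fps w) (Suc n) = fps_nth (?v - ?q * ?v) (Suc n)" for n by simp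
  then have "w (Suc n) - w n = v (Suc n) - (\<Sum>i\<le>Suc n. q i * v (Suc n - i))" for n
    by (simp add: left_diff_distrib fps_mult_nth[of ?q] flip: atMost_atLeast0)
  with renewal have "w n \<le> w (Suc n)" for n
    by (metis diff_ge_0_iff_ge)
  then have w_mono: "mono w" by (simp add: mono_iff_le_Suc)
  have w0: "0 \<le> w n" for n unfolding w_def using G v by (intro sum_nonneg) simp
  have le: "(\<Sum>n\<le>N. p n) * w j \<le> m * c" for N
  proof -
    have "(\<Sum>n\<le>N. p n) * w j \<le> (\<Sum>n\<le>N. p n * w (N + j - n))"
      unfolding sum_distrib_right using p(1) by (intro sum_mono mult_left_mono monoD[OF w_mono]) auto
    also have "\<dots> \<le> (\<Sum>n\<le>N + j. p n * w (N + j - n))"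
      using p(1) w0 by (intro sum_mono2) auto
    also have "\<dots> = fps_nth (?p * (?G * ?v)) (N + j)"
      by (simp add: fps_mult_nth[of ?p] w[symmetric] atMost_atLeast0)
    also have "\<dots> = fps_nth (?G * (?p * ?v)) (N + j)" by (simp add: mult.left_commute)
    also have "\<dots> = (\<Sum>k\<le>N + j. G k * (\<Sum>n\<le>N + j - k. p n * v (N + j - k - n)))"
      by (simp add: fps_mult_nth atMost_atLeast0)
    also have "\<dots> \<le> (\<Sum>k\<le>N + j. G k * c)"
      by (rule sum_mono, rule mult_left_mono, rule delayed, rule G(1))
    also have "\<dots> \<le> m * c"
      unfolding sum_distrib_right[symmetric] using G c
      by (intro mult_right_mono) (auto simp: sums_iff intro!: sum_le_suminf)
    finally show ?thesis .
  qed
  have "(\<lambda>N. (\<Sum>n\<le>N. p n) * w j) \<longlonglongrightarrow> 1 * w j"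
    using p(2) unfolding sums_def_le by (intro tendsto_mult) auto
  then have "1 * w j \<le> m * c"
    using le by (intro LIMSEQ_le_const2) auto
  then show ?thesis by (simp add: w_def)
qed

section \<open>Convolutions with geometric sequences\<close>

lemma sum_by_parts_geometric:
  fixes G :: "nat \<Rightarrow> real"
  assumes \<rho>: "\<rho> \<noteq> 0" and p: "p 0 = 1 - G 0" "\<And>n. p (Suc n) = G n - G (Suc n)"
  shows "(\<Sum>n\<le>t. p n * \<rho> ^ (t - n)) = \<rho> ^ t + (1 - \<rho>) / \<rho> * (\<Sum>n<t. G n * \<rho> ^ (t - n)) - G t"
proof (induction t)
  case 0
  then show ?case by (simp add: p)
next
  case (Suc t)
  have shift: "(\<Sum>n\<le>t. h n * \<rho> ^ (Suc t - n)) = \<rho> * (\<Sum>n\<le>t. h n * \<rho> ^ (t - n))" for h :: "nat \<Rightarrow> real"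
    unfolding sum_distrib_left by (intro sum.cong) (auto simp: Suc_diff_le)
  have last: "(\<Sum>n\<le>t. G n * \<rho> ^ (t - n)) = (\<Sum>n<t. G n * \<rho> ^ (t - n)) + G t"
    by (simp flip: lessThan_Suc_atMost)
  show ?case
    using \<rho> by (simp add: shift Suc p lessThan_Suc_atMost last field_simps)
qed

text \<open>
  The error \<open>\<bar>v s - c\<bar>\<close> at the remaining time \<open>s = t - n\<close> is averaged over the time \<open>n\<close> with law \<open>p\<close>, whose tail
  is \<open>G\<close>; the event of probability \<open>G t\<close> that this time exceeds \<open>t\<close> contributes \<open>G t\<close>.  Summation by parts
  expresses everything through the tail \<open>G\<close>, and \<open>G t\<close> then occurs with the coefficient \<open>1 - D\<close>.  The
  geometric bound on \<open>G t\<close> may be inserted only where this coefficient is positive, which is the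
  origin of \<open>max (1 - D) 0\<close>.
\<close>

lemma convolution_geometric_bound:
  fixes G p v :: "nat \<Rightarrow> real"
  assumes \<rho>: "0 < \<rho>" "\<rho> < 1" and p: "\<And>n. 0 \<le> p n" "p 0 = 1 - G 0" "\<And>n. p (Suc n) = G n - G (Suc n)"
    and G: "\<And>n. 0 \<le> G n" "\<And>n. G n \<le> A * \<rho> ^ n" and D: "0 \<le> D"
    and v: "\<And>t. \<bar>v t - c\<bar> \<le> D * \<rho> ^ t" and c: "0 \<le> c" "c \<le> 1" and e: "0 \<le> e" "e \<le> G t"
  shows "\<bar>e + (\<Sum>n\<le>t. p n * v (t - n)) - c\<bar>
    \<le> ((1 - \<rho>) / \<rho> * D * A * real t + max (1 - D) 0 * A + D) * \<rho> ^ t"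
proof -
  have total: "(\<Sum>n\<le>t. p n) = 1 - G t" by (induction t) (simp_all add: p)
  have geom: "(\<Sum>n<t. G n * \<rho> ^ (t - n)) \<le> A * real t * \<rho> ^ t"
  proof -
    have "(\<Sum>n<t. G n * \<rho> ^ (t - n)) \<le> (\<Sum>n<t. A * \<rho> ^ n * \<rho> ^ (t - n))"
      using \<rho> G by (intro sum_mono mult_right_mono) auto
    also have "\<dots> = (\<Sum>n<t. A * \<rho> ^ t)"
      by (intro sum.cong) (auto simp: mult.assoc simp flip: power_add)
    finally show ?thesis by (simp add: mult_ac)
  qed
  have conv: "(\<Sum>n\<le>t. p n * \<rho> ^ (t - n)) \<le> \<rho> ^ t + (1 - \<rho>) / \<rho> * (A * real t * \<rho> ^ t) - G t"
    unfolding sum_by_parts_geometric[where p = p and G = G, OF less_imp_neq[OF \<rho>(1), symmetric] p(2,3)]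
    using \<rho> geom by (intro diff_right_mono add_left_mono mult_left_mono) auto
  have "e + (\<Sum>n\<le>t. p n * v (t - n)) - c = (e - G t * c) + (\<Sum>n\<le>t. p n * (v (t - n) - c))"
    by (simp add: right_diff_distrib sum_subtractf total flip: sum_distrib_right) (simp add: algebra_simps)
  also have "\<bar>\<dots>\<bar> \<le> \<bar>e - G t * c\<bar> + (\<Sum>n\<le>t. \<bar>p n * (v (t - n) - c)\<bar>)"
    by (intro order_trans[OF abs_triangle_ineq] add_left_mono sum_abs)
  also have "\<bar>e - G t * c\<bar> \<le> G t"
    using e c(1) mult_left_le[OF c(2) G(1)[of t]] mult_nonneg_nonneg[OF G(1)[of t] c(1)] by linarith
  also have "(\<Sum>n\<le>t. \<bar>p n * (v (t - n) - c)\<bar>) \<le> (\<Sum>n\<le>t. D * (p n * \<rho> ^ (t - n)))"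
  proof (rule sum_mono)
    fix n
    show "\<bar>p n * (v (t - n) - c)\<bar> \<le> D * (p n * \<rho> ^ (t - n))"
      using mult_left_mono[OF v[of "t - n"] p(1)[of n]] p(1)[of n] by (simp add: abs_mult mult_ac)
  qed
  also have "\<dots> \<le> D * (\<rho> ^ t + (1 - \<rho>) / \<rho> * (A * real t * \<rho> ^ t) - G t)"
    unfolding sum_distrib_left[symmetric] using conv D by (rule mult_left_mono)
  finally have "\<bar>e + (\<Sum>n\<le>t. p n * v (t - n)) - c\<bar>
      \<le> G t + D * (\<rho> ^ t + (1 - \<rho>) / \<rho> * (A * real t * \<rho> ^ t) - G t)" by simp
  also have "\<dots> = (1 - D) * G t + ((1 - \<rho>) / \<rho> * D * A * real t + D) * \<rho> ^ t"
    by (simp add: algebra_simps)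
  also have "(1 - D) * G t \<le> max (1 - D) 0 * (A * \<rho> ^ t)"
    using G by (intro order_trans[OF mult_right_mono[of "1 - D" "max (1 - D) 0"] mult_left_mono]) auto
  finally show ?thesis by (simp add: algebra_simps)
qed

section \<open>Bounded measurable functions and Markov kernels\<close>

text \<open>
  All operator theory below takes place on bounded measurable functions.  This loses nothing: the
  densities that occur are bounded, and the positivity argument only tests the quadratic form of the
  kernel against such functions.
\<close>

definition bounded_measurable :: "'a measure \<Rightarrow> ('a \<Rightarrow> real) set" where
  "bounded_measurable M = {f \<in> borel_measurable M. \<exists>B. \<forall>x\<in>space M. \<bar>f x\<bar> \<le> B}"

lemma bounded_measurableI:
  "f \<in> borel_measurable M \<Longrightarrow> (\<And>x. x \<in> space M \<Longrightarrow> \<bar>f x\<bar> \<le> B) \<Longrightarrow> f \<in> bounded_measurable M"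
  by (auto simp: bounded_measurable_def)

lemma bounded_measurableE:
  assumes "f \<in> bounded_measurable M"
  obtains B where "0 \<le> B" "f \<in> borel_measurable M" "\<And>x. x \<in> space M \<Longrightarrow> \<bar>f x\<bar> \<le> B"
proof -
  from assms obtain B where B: "f \<in> borel_measurable M" "\<And>x. x \<in> space M \<Longrightarrow> \<bar>f x\<bar> \<le> B"
    by (auto simp: bounded_measurable_def)
  from that[of "\<bar>B\<bar>"] B show thesis by force
qed

lemma bounded_measurableD: "f \<in> bounded_measurable M \<Longrightarrow> f \<in> borel_measurable M"
  by (simp add: bounded_measurable_def)

lemma bounded_measurable_const: "(\<lambda>_. c) \<in> bounded_measurable M"
  by (rule bounded_measurableI[where B = "\<bar>c\<bar>"]) auto

lemma bounded_measurable_indicator: "S \<in> sets M \<Longrightarrow> indicator S \<in> bounded_measurable M"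
  by (rule bounded_measurableI[where B = 1]) (auto simp: indicator_def)

lemma bounded_measurable_add:
  assumes "f \<in> bounded_measurable M" "g \<in> bounded_measurable M"
  shows "(\<lambda>x. f x + g x) \<in> bounded_measurable M"
proof -
  from assms obtain A B where [measurable]: "f \<in> borel_measurable M" "g \<in> borel_measurable M"
    and "\<And>x. x \<in> space M \<Longrightarrow> \<bar>f x\<bar> \<le> A" "\<And>x. x \<in> space M \<Longrightarrow> \<bar>g x\<bar> \<le> B"
    by (elim bounded_measurableE) blast
  then show ?thesis
    by (intro bounded_measurableI[where B = "A + B"]) (auto intro!: order_trans[OF abs_triangle_ineq] add_mono)
qed

lemma bounded_measurable_mult:
  assumes "f \<in> bounded_measurable M" "g \<in> bounded_measurable M"
  shows "(\<lambda>x. f x * g x) \<in> bounded_measurable M"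
proof -
  from assms obtain A B where [measurable]: "f \<in> borel_measurable M" "g \<in> borel_measurable M"
    and "0 \<le> A" "\<And>x. x \<in> space M \<Longrightarrow> \<bar>f x\<bar> \<le> A" "\<And>x. x \<in> space M \<Longrightarrow> \<bar>g x\<bar> \<le> B"
    by (elim bounded_measurableE) blast
  then show ?thesis
    by (intro bounded_measurableI[where B = "A * B"]) (auto simp: abs_mult intro!: mult_mono)
qed

lemma bounded_measurable_cmult:
  "f \<in> bounded_measurable M \<Longrightarrow> (\<lambda>x. c * f x) \<in> bounded_measurable M"
  by (intro bounded_measurable_mult bounded_measurable_const)

lemma bounded_measurable_diff:
  "f \<in> bounded_measurable M \<Longrightarrow> g \<in> bounded_measurable M \<Longrightarrow> (\<lambda>x. f x - g x) \<in> bounded_measurable M"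
  using bounded_measurable_add[of f M "\<lambda>x. (- 1) * g x"] bounded_measurable_cmult[of g M "- 1"] by simp

lemma bounded_measurable_power2:
  "f \<in> bounded_measurable M \<Longrightarrow> (\<lambda>x. (f x)\<^sup>2) \<in> bounded_measurable M"
  by (simp add: power2_eq_square bounded_measurable_mult)

lemma bounded_measurable_sum:
  "(\<And>i. i \<in> I \<Longrightarrow> f i \<in> bounded_measurable M) \<Longrightarrow> (\<lambda>x. \<Sum>i\<in>I. f i x) \<in> bounded_measurable M"
  by (induction I rule: infinite_finite_induct) (auto intro: bounded_measurable_const bounded_measurable_add)

lemmas bounded_measurable_intros = bounded_measurable_const bounded_measurable_indicator
  bounded_measurable_add bounded_measurable_mult bounded_measurable_diff
  bounded_measurable_power2 bounded_measurable_sum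

lemma integrable_bounded_measurable:
  assumes f: "f \<in> bounded_measurable M" and N: "sets N = sets M" "prob_space N"
  shows "integrable N f"
proof -
  interpret prob_space N by fact
  from f obtain B where "f \<in> borel_measurable M" "\<And>x. x \<in> space M \<Longrightarrow> \<bar>f x\<bar> \<le> B"
    by (elim bounded_measurableE) blast
  moreover have "space N = space M" using N(1) by (rule sets_eq_imp_space_eq)
  ultimately show ?thesis
    by (intro integrable_const_bound[where B = B]) (auto simp: measurable_cong_sets[OF N(1) refl])
qed

locale bounded_kernel =
  fixes M :: "'a measure" and P :: "'a \<Rightarrow> 'a measure"
  assumes kernel: "P \<in> M \<rightarrow>\<^sub>M prob_algebra M"
begin

lemma kernel_sets: "x \<in> space M \<Longrightarrow> sets (P x) = sets M"
  and kernel_prob: "x \<in> space M \<Longrightarrow> prob_space (P x)"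
  using measurable_space[OF kernel] by (auto simp: space_prob_algebra)

lemma kernel_integrable: "f \<in> bounded_measurable M \<Longrightarrow> x \<in> space M \<Longrightarrow> integrable (P x) f"
  using kernel_sets kernel_prob by (blast intro: integrable_bounded_measurable)

lemma kernel_op_const: "x \<in> space M \<Longrightarrow> kernel_op P (\<lambda>_. c) x = c"
  using prob_space.prob_space[OF kernel_prob, of x] by (simp add: kernel_op_def)

lemma kernel_op_add: "f \<in> bounded_measurable M \<Longrightarrow> g \<in> bounded_measurable M \<Longrightarrow> x \<in> space M \<Longrightarrow>
    kernel_op P (\<lambda>y. f y + g y) x = kernel_op P f x + kernel_op P g x"
  by (simp add: kernel_op_def kernel_integrable)

lemma kernel_op_cmult: "kernel_op P (\<lambda>y. c * f y) x = c * kernel_op P f x"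
  by (simp add: kernel_op_def)

lemma kernel_op_bounds:
  assumes f: "f \<in> bounded_measurable M" and x: "x \<in> space M"
    and "\<And>y. y \<in> space M \<Longrightarrow> a \<le> f y" "\<And>y. y \<in> space M \<Longrightarrow> f y \<le> b"
  shows "a \<le> kernel_op P f x" "kernel_op P f x \<le> b"
proof -
  interpret prob_space "P x" using x by (rule kernel_prob)
  have sp: "space (P x) = space M" using kernel_sets[OF x] by (rule sets_eq_imp_space_eq)
  show "a \<le> kernel_op P f x" "kernel_op P f x \<le> b" unfolding kernel_op_def
    using assms sp by (auto intro!: integral_ge_const integral_le_const kernel_integrable)
qed

lemma bounded_measurable_kernel_op:
  assumes "f \<in> bounded_measurable M"
  shows "kernel_op P f \<in> bounded_measurable M"
proof -
  from assms obtain B where f: "f \<in> borel_measurable M" "\<And>x. x \<in> space M \<Longrightarrow> \<bar>f x\<bar> \<le> B"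
    by (elim bounded_measurableE) blast
  show ?thesis
  proof (rule bounded_measurableI)
    have "(\<lambda>x. integral\<^sup>L (P x) f) \<in> borel_measurable M"
      using measurable_compose[OF measurable_prob_algebraD[OF kernel] integral_measurable_subprob_algebra[OF f(1)]] .
    then show "kernel_op P f \<in> borel_measurable M" by (simp add: kernel_op_def[abs_def])
    show "\<bar>kernel_op P f x\<bar> \<le> B" if "x \<in> space M" for x
      using kernel_op_bounds[OF assms that, of "- B" B] f(2) by (force simp: abs_le_iff)
  qed
qed

lemma bounded_measurable_kernel_iter:
  "f \<in> bounded_measurable M \<Longrightarrow> (kernel_op P ^^ n) f \<in> bounded_measurable M"
  by (induction n) (auto intro: bounded_measurable_kernel_op)

text \<open>
  Jensen's inequality: the variance of \<open>f\<close> under \<open>P x\<close> is nonnegative.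
\<close>

lemma kernel_op_power2_le:
  assumes f: "f \<in> bounded_measurable M" and x: "x \<in> space M"
  shows "(kernel_op P f x)\<^sup>2 \<le> kernel_op P (\<lambda>y. (f y)\<^sup>2) x"
proof -
  interpret prob_space "P x" using x by (rule kernel_prob)
  have "0 \<le> variance f" by simp
  also have "variance f = expectation (\<lambda>y. (f y)\<^sup>2) - (expectation f)\<^sup>2"
    using f x by (intro variance_eq kernel_integrable bounded_measurable_intros)
  finally show ?thesis by (simp add: kernel_op_def)
qed

end

section \<open>Self-adjointness and positivity of a reversible kernel\<close>

text \<open>
  The discriminant argument behind every Cauchy-Schwarz inequality.  It is stated for numbers since it
  serves both the inner product of \<open>L\<^sup>2(\<pi>)\<close> and the form of the operator \<open>P - l I\<close>.
\<close>

lemma discriminant_nonpos: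
  fixes a b c :: real
  assumes "\<And>s. 0 \<le> a + 2 * s * b + s\<^sup>2 * c"
  shows "b\<^sup>2 \<le> a * c"
proof (cases "c = 0")
  case True
  have "b = 0"
  proof (rule ccontr)
    assume "b \<noteq> 0"
    with assms[of "- (a + 1) / (2 * b)"] True show False by (simp add: field_simps)
  qed
  with True show ?thesis by simp
next
  case False
  have c: "0 < c"
  proof (rule ccontr)
    assume "\<not> 0 < c"
    with False have "c < 0" by simp
    \<comment> \<open>A value of \<open>s\<close> for which the negative quadratic term outweighs the other two.\<close>
    define s where "s = 1 + (\<bar>a\<bar> + 2 * \<bar>b\<bar>) / (- c)"
    have s1: "1 \<le> s" and s2: "(s - 1) * (- c) = \<bar>a\<bar> + 2 * \<bar>b\<bar>"
      using \<open>c < 0\<close> by (simp_all add: s_def divide_nonneg_pos divide_nonneg_neg)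
    have "a + 2 * s * b + s\<^sup>2 * c \<le> s * \<bar>a\<bar> + 2 * s * \<bar>b\<bar> + s\<^sup>2 * c"
    proof -
      have "a \<le> \<bar>a\<bar>" "\<bar>a\<bar> \<le> s * \<bar>a\<bar>" "s * b \<le> s * \<bar>b\<bar>"
        using s1 mult_right_mono[of 1 s "\<bar>a\<bar>"] by (auto intro: mult_left_mono)
      then show ?thesis by simp
    qed
    also have "\<dots> = s * c"
      using s2 by (simp add: power2_eq_square algebra_simps) (metis distrib_left mult.commute mult.left_commute add.commute)
    also have "\<dots> < 0" using s1 \<open>c < 0\<close> by (simp add: mult_pos_neg)
    finally show False using assms[of s] by simp
  qed
  have "0 \<le> a + 2 * (- b / c) * b + (- b / c)\<^sup>2 * c" by (rule assms)
  also have "\<dots> = a - b\<^sup>2 / c" using c by (simp add: power2_eq_square field_simps)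
  finally show ?thesis using c by (simp add: field_simps)
qed

definition L2_inner :: "'a measure \<Rightarrow> ('a \<Rightarrow> real) \<Rightarrow> ('a \<Rightarrow> real) \<Rightarrow> real" where
  "L2_inner \<pi> f g = (\<integral>x. f x * g x \<partial>\<pi>)"

locale reversible_kernel = bounded_kernel +
  fixes \<pi> :: "'a measure"
  assumes pi: "\<pi> \<in> space (prob_algebra M)" and rev: "reversible_wrt M P \<pi>"
begin

lemma pi_sets [measurable_cong]: "sets \<pi> = sets M"
  and pi_prob: "prob_space \<pi>"
  using pi by (auto simp: space_prob_algebra)

lemma pi_space: "space \<pi> = space M"
  using pi_sets by (rule sets_eq_imp_space_eq)

lemma pi_integrable: "f \<in> bounded_measurable M \<Longrightarrow> integrable \<pi> f"
  using pi_sets pi_prob by (blast intro: integrable_bounded_measurable)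

lemma L2_inner_commute: "L2_inner \<pi> f g = L2_inner \<pi> g f"
  by (simp add: L2_inner_def mult.commute)

lemma L2_inner_self_nonneg: "0 \<le> L2_inner \<pi> f f"
  by (simp add: L2_inner_def)

lemma L2_inner_cong:
  "(\<And>x. x \<in> space M \<Longrightarrow> f x = f' x) \<Longrightarrow> (\<And>x. x \<in> space M \<Longrightarrow> g x = g' x) \<Longrightarrow>
    L2_inner \<pi> f g = L2_inner \<pi> f' g'"
  unfolding L2_inner_def by (intro Bochner_Integration.integral_cong) (auto simp: pi_space)

lemma L2_inner_add_left:
  "f \<in> bounded_measurable M \<Longrightarrow> g \<in> bounded_measurable M \<Longrightarrow> h \<in> bounded_measurable M \<Longrightarrow>
    L2_inner \<pi> (\<lambda>x. f x + g x) h = L2_inner \<pi> f h + L2_inner \<pi> g h"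
  unfolding L2_inner_def distrib_right
  by (intro Bochner_Integration.integral_add pi_integrable bounded_measurable_intros)

lemma L2_inner_cmult_left: "L2_inner \<pi> (\<lambda>x. c * f x) h = c * L2_inner \<pi> f h"
  by (simp add: L2_inner_def mult.assoc)

lemma L2_inner_diff_left:
  "f \<in> bounded_measurable M \<Longrightarrow> g \<in> bounded_measurable M \<Longrightarrow> h \<in> bounded_measurable M \<Longrightarrow>
    L2_inner \<pi> (\<lambda>x. f x - g x) h = L2_inner \<pi> f h - L2_inner \<pi> g h"
  unfolding L2_inner_def left_diff_distrib
  by (intro Bochner_Integration.integral_diff pi_integrable bounded_measurable_intros)

text \<open>
  Reversibility identifies two measures on pairs; tested on \<open>f(x) g(y)\<close>, their equality becomes
  self-adjointness of the kernel on bounded functions.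
\<close>

lemma integral_pair_kernel:
  assumes f: "f \<in> bounded_measurable M" and g: "g \<in> bounded_measurable M"
  shows "(\<integral>z. f (fst z) * g (snd z) \<partial>(\<pi> \<bind> (\<lambda>x. distr (P x) (M \<Otimes>\<^sub>M M) (\<lambda>y. (x, y)))))
      = L2_inner \<pi> f (kernel_op P g)" (is ?forward)
    and "(\<integral>z. f (fst z) * g (snd z) \<partial>(\<pi> \<bind> (\<lambda>y. distr (P y) (M \<Otimes>\<^sub>M M) (\<lambda>x. (x, y)))))
      = L2_inner \<pi> (kernel_op P f) g" (is ?backward)
proof -
  from f g obtain A B where fg [measurable]: "f \<in> borel_measurable M" "g \<in> borel_measurable M"
    and A: "0 \<le> A" "\<And>x. x \<in> space M \<Longrightarrow> \<bar>f x\<bar> \<le> A" and B: "\<And>x. x \<in> space M \<Longrightarrow> \<bar>g x\<bar> \<le> B"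
    by (elim bounded_measurableE) blast
  have bound: "\<bar>f (fst z) * g (snd z)\<bar> \<le> A * B" if "z \<in> space (M \<Otimes>\<^sub>M M)" for z
    using that A B by (auto simp: abs_mult space_pair_measure intro!: mult_mono)
  have fin: "finite_measure \<pi>" using pi_prob by (rule prob_space.finite_measure)
  note P [measurable] = measurable_prob_algebraD[OF kernel]
  note [measurable] = measurable_distr2
  have K: "(\<lambda>x. distr (P x) (M \<Otimes>\<^sub>M M) (h x)) \<in> M \<rightarrow>\<^sub>M prob_algebra (M \<Otimes>\<^sub>M M)"
    if "(\<lambda>(x, y). h x y) \<in> M \<Otimes>\<^sub>M M \<rightarrow>\<^sub>M M \<Otimes>\<^sub>M M" for h
    using kernel that by (rule measurable_distr_prob_space2)
  have mass: "AE x in \<pi>. emeasure (K x) (space (M \<Otimes>\<^sub>M M)) \<le> 1"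
    if "K \<in> M \<rightarrow>\<^sub>M prob_algebra (M \<Otimes>\<^sub>M M)" for K
    using measurable_space[OF that]
    by (intro AE_I2) (simp add: pi_space in_space_prob_algebra)
  have inner: "(\<integral>z. f (fst z) * g (snd z) \<partial>distr (P x) (M \<Otimes>\<^sub>M M) (h x))
      = (\<integral>y. f (fst (h x y)) * g (snd (h x y)) \<partial>P x)"
    if "x \<in> space M" "h x \<in> M \<rightarrow>\<^sub>M M \<Otimes>\<^sub>M M" for x and h :: "'a \<Rightarrow> 'a \<Rightarrow> 'a \<times> 'a"
    using that by (intro integral_distr) (auto simp: measurable_cong_sets[OF kernel_sets refl])
  show ?forward
    unfolding L2_inner_def
    by (subst integral_bind[where K = "M \<Otimes>\<^sub>M M" and B = "A * B" and B' = 1])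
      (auto simp: inner pi_space kernel_op_def measurable_cong_sets[OF pi_sets refl] intro!: bound fin mass K
        measurable_prob_algebraD Bochner_Integration.integral_cong)
  show ?backward
    unfolding L2_inner_def
    by (subst integral_bind[where K = "M \<Otimes>\<^sub>M M" and B = "A * B" and B' = 1])
      (auto simp: inner[of _ "\<lambda>y x. (x, y)"] pi_space kernel_op_def measurable_cong_sets[OF pi_sets refl] intro!: bound fin mass K
        measurable_prob_algebraD Bochner_Integration.integral_cong)
qed

lemma kernel_op_self_adjoint:
  "f \<in> bounded_measurable M \<Longrightarrow> g \<in> bounded_measurable M \<Longrightarrow>
    L2_inner \<pi> f (kernel_op P g) = L2_inner \<pi> (kernel_op P f) g"
  using integral_pair_kernel[of f g] rev by (simp add: reversible_wrt_def)

lemma integral_kernel_op: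
  assumes g: "g \<in> bounded_measurable M"
  shows "(\<integral>x. kernel_op P g x \<partial>\<pi>) = (\<integral>x. g x \<partial>\<pi>)"
proof -
  have "L2_inner \<pi> (\<lambda>_. 1) (kernel_op P g) = L2_inner \<pi> (kernel_op P (\<lambda>_. 1)) g"
    using g by (intro kernel_op_self_adjoint bounded_measurable_intros)
  also have "\<dots> = L2_inner \<pi> (\<lambda>_. 1) g"
    by (intro L2_inner_cong kernel_op_const) auto
  finally show ?thesis by (simp add: L2_inner_def)
qed

lemma integral_kernel_iter:
  "g \<in> bounded_measurable M \<Longrightarrow> (\<integral>x. (kernel_op P ^^ n) g x \<partial>\<pi>) = (\<integral>x. g x \<partial>\<pi>)"
  by (induction n) (auto simp: integral_kernel_op bounded_measurable_kernel_iter)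

lemma kernel_iter_self_adjoint:
  assumes f: "f \<in> bounded_measurable M" and g: "g \<in> bounded_measurable M"
  shows "L2_inner \<pi> f ((kernel_op P ^^ n) g) = L2_inner \<pi> ((kernel_op P ^^ n) f) g"
  using f
proof (induction n arbitrary: f)
  case (Suc n)
  then show ?case
    using g by (simp add: kernel_op_self_adjoint bounded_measurable_kernel_iter bounded_measurable_kernel_op
        flip: funpow_swap1)
qed simp

lemma kernel_op_contraction:
  assumes f: "f \<in> bounded_measurable M"
  shows "L2_inner \<pi> (kernel_op P f) (kernel_op P f) \<le> L2_inner \<pi> f f"
proof -
  have "L2_inner \<pi> (kernel_op P f) (kernel_op P f) \<le> (\<integral>x. kernel_op P (\<lambda>y. (f y)\<^sup>2) x \<partial>\<pi>)"
    unfolding L2_inner_def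
    using kernel_op_power2_le[OF f] f
    by (intro integral_mono pi_integrable bounded_measurable_intros bounded_measurable_kernel_op)
      (auto simp: pi_space power2_eq_square)
  also have "\<dots> = L2_inner \<pi> f f"
    using f by (simp add: L2_inner_def power2_eq_square integral_kernel_op bounded_measurable_intros)
  finally show ?thesis .
qed

lemma L2_inner_Cauchy_Schwarz:
  assumes f: "f \<in> bounded_measurable M" and g: "g \<in> bounded_measurable M"
  shows "(L2_inner \<pi> f g)\<^sup>2 \<le> L2_inner \<pi> f f * L2_inner \<pi> g g"
proof (rule discriminant_nonpos)
  fix s :: real
  have "0 \<le> L2_inner \<pi> (\<lambda>x. f x + s * g x) (\<lambda>x. f x + s * g x)" by (rule L2_inner_self_nonneg)
  also have "\<dots> = (\<integral>x. f x * f x + 2 * s * (f x * g x) + s\<^sup>2 * (g x * g x) \<partial>\<pi>)"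
    unfolding L2_inner_def by (simp add: algebra_simps power2_eq_square)
  also have "\<dots> = L2_inner \<pi> f f + 2 * s * L2_inner \<pi> f g + s\<^sup>2 * L2_inner \<pi> g g"
    unfolding L2_inner_def using f g by (simp add: pi_integrable bounded_measurable_intros)
  finally show "0 \<le> L2_inner \<pi> f f + 2 * s * L2_inner \<pi> f g + s\<^sup>2 * L2_inner \<pi> g g" .
qed

definition shifted_op :: "real \<Rightarrow> ('a \<Rightarrow> real) \<Rightarrow> 'a \<Rightarrow> real" where
  "shifted_op l f x = kernel_op P f x - l * f x"

lemma bounded_measurable_shifted_op:
  "f \<in> bounded_measurable M \<Longrightarrow> shifted_op l f \<in> bounded_measurable M"
  unfolding shifted_op_def[abs_def] by (intro bounded_measurable_intros bounded_measurable_kernel_op)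

lemma shifted_op_inner:
  assumes "f \<in> bounded_measurable M" "g \<in> bounded_measurable M"
  shows "L2_inner \<pi> (shifted_op l f) g = L2_inner \<pi> (kernel_op P f) g - l * L2_inner \<pi> f g"
  unfolding shifted_op_def[abs_def]
  using assms by (simp add: L2_inner_diff_left L2_inner_cmult_left bounded_measurable_intros bounded_measurable_kernel_op)

lemma shifted_op_Cauchy_Schwarz:
  assumes pos: "\<And>h. h \<in> bounded_measurable M \<Longrightarrow> 0 \<le> L2_inner \<pi> (shifted_op l h) h"
    and f: "f \<in> bounded_measurable M" and g: "g \<in> bounded_measurable M"
  shows "(L2_inner \<pi> (shifted_op l f) g)\<^sup>2 \<le> L2_inner \<pi> (shifted_op l f) f * L2_inner \<pi> (shifted_op l g) g"
proof (rule discriminant_nonpos)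
  fix s :: real
  let ?B = "\<lambda>f g. L2_inner \<pi> (shifted_op l f) g"
  let ?h = "\<lambda>x. f x + s * g x"
  have sym: "?B g f = ?B f g"
    using kernel_op_self_adjoint[OF g f] L2_inner_commute[of g "kernel_op P f"] L2_inner_commute[of g f] f g
    by (simp add: shifted_op_inner)
  have h: "?h \<in> bounded_measurable M" using f g by (intro bounded_measurable_intros)
  have lin: "?B ?h k = ?B f k + s * ?B g k" if "k \<in> bounded_measurable M" for k
  proof -
    have "?B ?h k = L2_inner \<pi> (\<lambda>x. shifted_op l f x + s * shifted_op l g x) k"
      using f g by (intro L2_inner_cong)
        (auto simp: shifted_op_def kernel_op_add kernel_op_cmult bounded_measurable_intros algebra_simps)
    then show ?thesis
      using f g that by (simp add: L2_inner_add_left L2_inner_cmult_left bounded_measurable_shifted_op bounded_measurable_intros)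
  qed
  have lin': "L2_inner \<pi> k ?h = L2_inner \<pi> k f + s * L2_inner \<pi> k g" if "k \<in> bounded_measurable M" for k
    unfolding L2_inner_commute[of k]
    using f g that by (simp add: L2_inner_add_left L2_inner_cmult_left bounded_measurable_intros)
  have "0 \<le> ?B ?h ?h" using h by (rule pos)
  also have "\<dots> = ?B f f + 2 * s * ?B f g + s\<^sup>2 * ?B g g"
    using f g h by (simp add: lin lin' bounded_measurable_shifted_op sym power2_eq_square algebra_simps)
  finally show "0 \<le> ?B f f + 2 * s * ?B f g + s\<^sup>2 * ?B g g" .
qed

lemma kernel_op_inner_bounds:
  assumes f: "f \<in> bounded_measurable M"
  shows "\<bar>L2_inner \<pi> (kernel_op P f) f\<bar> \<le> L2_inner \<pi> f f"
proof -
  have "(L2_inner \<pi> (kernel_op P f) f)\<^sup>2 \<le> L2_inner \<pi> (kernel_op P f) (kernel_op P f) * L2_inner \<pi> f f"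
    using f by (intro L2_inner_Cauchy_Schwarz bounded_measurable_kernel_op)
  also have "\<dots> \<le> (L2_inner \<pi> f f)\<^sup>2"
    unfolding power2_eq_square using f by (intro mult_right_mono kernel_op_contraction L2_inner_self_nonneg)
  finally show ?thesis using L2_inner_self_nonneg[of f] by (simp flip: abs_le_square_iff)
qed

text \<open>
  Cauchy-Schwarz for the positive form \<open>B(f,g) = \<langle>(P - l) f, g\<rangle>\<close>, applied to \<open>g = (P - l) f\<close>, gives
  \<open>\<parallel>g\<parallel>\<^sup>4 = B(f,g)\<^sup>2 \<le> B(f,f) B(g,g)\<close>, and \<open>B(g,g) \<le> (1 - l) \<parallel>g\<parallel>\<^sup>2\<close> because \<open>P\<close> is a contraction.
  It is used at the bottom \<open>l\<close> of the spectrum and, once \<open>P\<close> is known to be positive, at \<open>l = 0\<close>.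
\<close>

lemma shifted_op_norm_le:
  assumes pos: "\<And>h. h \<in> bounded_measurable M \<Longrightarrow> 0 \<le> L2_inner \<pi> (shifted_op l h) h"
    and f: "f \<in> bounded_measurable M"
  shows "L2_inner \<pi> (shifted_op l f) (shifted_op l f) \<le> (1 - l) * L2_inner \<pi> (shifted_op l f) f"
proof -
  define g where "g = shifted_op l f"
  define b where "b = L2_inner \<pi> (shifted_op l f) f"
  let ?N = "L2_inner \<pi> g g"
  have g: "g \<in> bounded_measurable M" unfolding g_def using f by (rule bounded_measurable_shifted_op)
  have b: "0 \<le> b" unfolding b_def using f by (rule pos)
  have Bg: "L2_inner \<pi> (shifted_op l g) g \<le> (1 - l) * ?N"
    using kernel_op_inner_bounds[OF g] by (simp add: shifted_op_inner g left_diff_distrib)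
  have "?N\<^sup>2 \<le> b * L2_inner \<pi> (shifted_op l g) g"
    unfolding b_def using shifted_op_Cauchy_Schwarz[OF pos f g] by (simp add: g_def)
  also have "\<dots> \<le> b * ((1 - l) * ?N)" using Bg b by (rule mult_left_mono)
  finally have "?N * ?N \<le> ((1 - l) * b) * ?N" by (simp add: power2_eq_square mult_ac)
  then have "?N \<le> (1 - l) * b" if "0 < ?N" using that by simp
  moreover have "0 \<le> (1 - l) * b" if "?N = 0"
  proof (cases "L2_inner \<pi> f f = 0")
    case True
    then have "b = 0" using kernel_op_inner_bounds[OF f] f by (simp add: b_def shifted_op_inner)
    then show ?thesis by simp
  next
    case False
    then have "0 < L2_inner \<pi> f f" using L2_inner_self_nonneg[of f] by simp
    moreover have "0 \<le> (1 - l) * L2_inner \<pi> f f"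
      using pos[OF f] kernel_op_inner_bounds[OF f] f by (simp add: shifted_op_inner left_diff_distrib)
    ultimately have "0 \<le> 1 - l" by (simp add: zero_le_mult_iff)
    with b show ?thesis by simp
  qed
  ultimately show ?thesis
    using L2_inner_self_nonneg[of g] unfolding b_def[symmetric] unfolding g_def[symmetric] by (cases "?N = 0") auto
qed

text \<open>
  A bounded function is itself the unique preimage of its image under \<open>P - l I\<close>, so the bound on the
  inverse is a lower bound on \<open>P - l I\<close>.
\<close>

lemma resolvent_lower_bound:
  assumes l: "l \<in> L2_resolvent_set \<pi> (kernel_op P)"
  obtains C where "\<And>f. f \<in> bounded_measurable M \<Longrightarrow> L2_inner \<pi> f f \<le> C * L2_inner \<pi> (shifted_op l f) (shifted_op l f)"
proof -
  from l obtain C where C: "\<And>g. g \<in> L2_fun \<pi> \<Longrightarrow> \<exists>f\<in>L2_fun \<pi>.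
      L2_norm_fun \<pi> f \<le> C * L2_norm_fun \<pi> g \<and>
      (\<forall>f'\<in>L2_fun \<pi>. (AE x in \<pi>. kernel_op P f' x - l * f' x = g x) \<longrightarrow> (AE x in \<pi>. f' x = f x))"
    unfolding L2_resolvent_set_def by blast
  have L2: "f \<in> L2_fun \<pi>" if "f \<in> bounded_measurable M" for f
    using that pi_integrable bounded_measurable_power2 bounded_measurableD
    by (auto simp: L2_fun_def measurable_cong_sets[OF pi_sets refl])
  have norm: "(L2_norm_fun \<pi> f)\<^sup>2 = L2_inner \<pi> f f" for f
    by (simp add: L2_norm_fun_def L2_inner_def power2_eq_square)
  show thesis
  proof (rule that[of "C\<^sup>2"])
    fix f assume f: "f \<in> bounded_measurable M"
    let ?g = "shifted_op l f"
    obtain f' where f': "f' \<in> L2_fun \<pi>" "L2_norm_fun \<pi> f' \<le> C * L2_norm_fun \<pi> ?g" "AE x in \<pi>. f x = f' x"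
      using C[of ?g] L2[OF f] L2[OF bounded_measurable_shifted_op[OF f, of l]]
      by (auto simp: shifted_op_def)
    have "L2_norm_fun \<pi> f = L2_norm_fun \<pi> f'"
      unfolding L2_norm_fun_def
      using f'(1,3) L2[OF f] by (intro arg_cong[where f = sqrt] integral_cong_AE) (auto simp: L2_fun_def)
    with f'(2) have "L2_norm_fun \<pi> f \<le> C * L2_norm_fun \<pi> ?g" by simp
    moreover have "0 \<le> L2_norm_fun \<pi> f" by (simp add: L2_norm_fun_def)
    ultimately have "(L2_norm_fun \<pi> f)\<^sup>2 \<le> (C * L2_norm_fun \<pi> ?g)\<^sup>2" by (intro power_mono)
    then show "L2_inner \<pi> f f \<le> C\<^sup>2 * L2_inner \<pi> ?g ?g" by (simp add: power_mult_distrib norm)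
  qed
qed

text \<open>
  Let \<open>lam\<close> be the largest number with \<open>lam \<langle>h, h\<rangle> \<le> \<langle>P h, h\<rangle>\<close> for all \<open>h\<close>.  If it were negative, it
  would belong to the resolvent set, so that \<open>P - lam I\<close> is bounded below in norm.  By
  \<open>shifted_op_norm_le\<close> the form of \<open>P - lam I\<close> is then at least a positive multiple of \<open>\<langle>h, h\<rangle>\<close>, and \<open>lam\<close> could be increased.
\<close>

lemma kernel_op_positive:
  assumes nonneg: "nonneg_eigenvalues P \<pi>" and f: "f \<in> bounded_measurable M"
  shows "0 \<le> L2_inner \<pi> (kernel_op P f) f"
proof (rule ccontr)
  assume "\<not> 0 \<le> L2_inner \<pi> (kernel_op P f) f"
  then have f_neg: "L2_inner \<pi> (kernel_op P f) f < 0" by simp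
  define L where "L = {l. \<forall>h\<in>bounded_measurable M. l * L2_inner \<pi> h h \<le> L2_inner \<pi> (kernel_op P h) h}"
  define lam where "lam = Sup L"
  have neg: "l < 0" if "l \<in> L" for l
  proof (rule ccontr)
    assume "\<not> l < 0"
    then have "0 \<le> l * L2_inner \<pi> f f" by (simp add: L2_inner_self_nonneg)
    with that f f_neg show False unfolding L_def by force
  qed
  have "- 1 \<in> L"
    unfolding L_def using kernel_op_inner_bounds by (fastforce simp: abs_le_iff)
  moreover have bdd: "bdd_above L" using neg by (intro bdd_aboveI[where M = 0]) (simp add: less_imp_le)
  ultimately have ne: "L \<noteq> {}" by blast
  have "lam \<in> L" unfolding L_def
  proof (intro CollectI ballI)
    fix h assume h: "h \<in> bounded_measurable M"
    show "lam * L2_inner \<pi> h h \<le> L2_inner \<pi> (kernel_op P h) h"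
    proof (cases "L2_inner \<pi> h h = 0")
      case True
      then show ?thesis using kernel_op_inner_bounds[OF h] by simp
    next
      case False
      then have pos: "0 < L2_inner \<pi> h h" using L2_inner_self_nonneg[of h] by simp
      have "lam \<le> L2_inner \<pi> (kernel_op P h) h / L2_inner \<pi> h h"
        unfolding lam_def using h pos by (intro cSup_least ne) (auto simp: L_def field_simps)
      then show ?thesis using pos by (simp add: field_simps)
    qed
  qed
  then have lam_neg: "lam < 0" by (rule neg)
  then have "lam \<in> L2_resolvent_set \<pi> (kernel_op P)"
    using nonneg by (force simp: nonneg_eigenvalues_def L2_spectrum_def)
  from resolvent_lower_bound[OF this] obtain C where C: "\<And>f. f \<in> bounded_measurable M \<Longrightarrow>
      L2_inner \<pi> f f \<le> C * L2_inner \<pi> (shifted_op lam f) (shifted_op lam f)"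
    by blast
  have pos: "0 \<le> L2_inner \<pi> (shifted_op lam h) h" if "h \<in> bounded_measurable M" for h
    using \<open>lam \<in> L\<close> that by (simp add: L_def shifted_op_inner)
  \<comment> \<open>The bound on the inverse and \<open>shifted_op_norm_le\<close> lose the factors \<open>C\<close> and \<open>1 - lam\<close>; the summand 1 keeps \<open>K\<close> positive.\<close>
  define K where "K = (\<bar>C\<bar> + 1) * (1 - lam)"
  have K: "0 < K" using lam_neg by (simp add: K_def)
  have "lam + 1 / K \<in> L" unfolding L_def
  proof (intro CollectI ballI)
    fix h assume h: "h \<in> bounded_measurable M"
    have "L2_inner \<pi> h h \<le> C * L2_inner \<pi> (shifted_op lam h) (shifted_op lam h)" using h by (rule C)
    also have "\<dots> \<le> (\<bar>C\<bar> + 1) * L2_inner \<pi> (shifted_op lam h) (shifted_op lam h)"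
      by (intro mult_right_mono L2_inner_self_nonneg) simp
    also have "\<dots> \<le> (\<bar>C\<bar> + 1) * ((1 - lam) * L2_inner \<pi> (shifted_op lam h) h)"
      using pos h by (intro mult_left_mono shifted_op_norm_le) auto
    finally have "L2_inner \<pi> h h \<le> K * L2_inner \<pi> (shifted_op lam h) h" by (simp add: K_def mult_ac)
    then show "(lam + 1 / K) * L2_inner \<pi> h h \<le> L2_inner \<pi> (kernel_op P h) h"
      using K h by (simp add: shifted_op_inner field_simps)
  qed
  then have "lam + 1 / K \<le> lam" unfolding lam_def using bdd by (rule cSup_upper)
  then show False using K by simp
qed

text \<open>
  Spectrally this is \<open>r\<^sup>2 \<le> r\<close> on \<open>[0,1]\<close>.
\<close>

lemma kernel_op_square_le:
  assumes nonneg: "nonneg_eigenvalues P \<pi>" and f: "f \<in> bounded_measurable M"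
  shows "L2_inner \<pi> (kernel_op P f) (kernel_op P f) \<le> L2_inner \<pi> (kernel_op P f) f"
proof -
  have zero: "shifted_op 0 h = kernel_op P h" for h by (simp add: shifted_op_def fun_eq_iff)
  show ?thesis using shifted_op_norm_le[of 0 f] kernel_op_positive[OF nonneg] f by (simp add: zero)
qed

text \<open>
  Put half of the iterates on either side of the inner product, with \<open>h = P\<^sup>j f\<close>.  A step from \<open>2j\<close> to
  \<open>2j + 1\<close> compares \<open>\<langle>h, h\<rangle>\<close> with \<open>\<langle>P h, h\<rangle>\<close> and needs contraction only; a step from \<open>2j + 1\<close> to \<open>2j + 2\<close>
  compares \<open>\<langle>P h, h\<rangle>\<close> with \<open>\<langle>P h, P h\<rangle>\<close>, and this is where the spectrum has to be nonnegative.
\<close>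

lemma autocorrelation_decreasing:
  assumes nonneg: "nonneg_eigenvalues P \<pi>" and f: "f \<in> bounded_measurable M"
  shows "decseq (\<lambda>n. L2_inner \<pi> f ((kernel_op P ^^ n) f))"
proof (rule decseq_SucI)
  fix n
  define h where "h = (kernel_op P ^^ (n div 2)) f"
  have h: "h \<in> bounded_measurable M" unfolding h_def using f by (rule bounded_measurable_kernel_iter)
  have split: "L2_inner \<pi> f ((kernel_op P ^^ (n div 2 + j)) f) = L2_inner \<pi> h ((kernel_op P ^^ j) f)" for j
    using f by (simp add: h_def funpow_add kernel_iter_self_adjoint bounded_measurable_kernel_iter)
  show "L2_inner \<pi> f ((kernel_op P ^^ Suc n) f) \<le> L2_inner \<pi> f ((kernel_op P ^^ n) f)"
  proof (cases "even n")
    case True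
    then have *: "n = n div 2 + n div 2" "Suc n = n div 2 + Suc (n div 2)" by auto
    have "L2_inner \<pi> f ((kernel_op P ^^ n) f) = L2_inner \<pi> h h"
      by (subst *(1), subst split) (simp add: h_def)
    moreover have "L2_inner \<pi> f ((kernel_op P ^^ Suc n) f) = L2_inner \<pi> h (kernel_op P h)"
      by (subst *(2), subst split) (simp add: h_def)
    ultimately show ?thesis using kernel_op_inner_bounds[OF h] by (simp add: L2_inner_commute[of h "kernel_op P h"])
  next
    case False
    then have *: "n = n div 2 + Suc (n div 2)" "Suc n = n div 2 + Suc (Suc (n div 2))" by presburger+
    have "L2_inner \<pi> f ((kernel_op P ^^ n) f) = L2_inner \<pi> h (kernel_op P h)"
      by (subst *(1), subst split) (simp add: h_def)
    moreover have "L2_inner \<pi> f ((kernel_op P ^^ Suc n) f) = L2_inner \<pi> h (kernel_op P (kernel_op P h))"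
      by (subst *(2), subst split) (simp add: h_def)
    moreover have "\<dots> = L2_inner \<pi> (kernel_op P h) (kernel_op P h)"
      using h by (intro kernel_op_self_adjoint bounded_measurable_kernel_op)
    ultimately show ?thesis using kernel_op_square_le[OF nonneg h] by (simp add: L2_inner_commute[of h "kernel_op P h"])
  qed
qed

end

section \<open>Markov chains and strong random times\<close>

text \<open>
  Conditional probabilities only give identities between probabilities of events; this passes from
  them to integrals of functions of the chain.
\<close>

lemma integral_eq_of_measure_eq:
  fixes Y :: "'w \<Rightarrow> 'a"
  assumes N: "prob_space N" and A: "A \<in> sets N" and Y [measurable]: "Y \<in> N \<rightarrow>\<^sub>M M"
    and \<kappa>: "sets \<kappa> = sets M" "finite_measure \<kappa>"
    and eq: "\<And>S. S \<in> sets M \<Longrightarrow> measure N {\<omega> \<in> A. Y \<omega> \<in> S} = measure \<kappa> S"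
    and f: "f \<in> borel_measurable M"
  shows "(\<integral>\<omega>. indicator A \<omega> * f (Y \<omega>) \<partial>N) = (\<integral>x. f x \<partial>\<kappa> :: real)"
proof -
  interpret prob_space N by fact
  interpret \<kappa>: finite_measure \<kappa> by fact
  note [measurable] = A
  have "distr (density N (indicator A)) M Y = \<kappa>"
  proof (rule measure_eqI)
    fix S assume "S \<in> sets (distr (density N (indicator A)) M Y)"
    then have S [measurable]: "S \<in> sets M" by simp
    have "emeasure (distr (density N (indicator A)) M Y) S = (\<integral>\<^sup>+\<omega>. indicator {\<omega> \<in> A. Y \<omega> \<in> S} \<omega> \<partial>N)"
      by (simp add: emeasure_distr emeasure_density del: nn_integral_indicator)
        (auto intro!: nn_integral_cong simp: indicator_def simp del: nn_integral_indicator)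
    also have "\<dots> = emeasure N {\<omega> \<in> A. Y \<omega> \<in> S}"
    proof (rule nn_integral_indicator)
      have "{\<omega> \<in> A. Y \<omega> \<in> S} = A \<inter> {\<omega> \<in> space N. Y \<omega> \<in> S}" using sets.sets_into_space[OF A] by auto
      then show "{\<omega> \<in> A. Y \<omega> \<in> S} \<in> sets N" by simp
    qed
    also have "\<dots> = emeasure \<kappa> S"
      using eq[OF S] by (simp add: emeasure_eq_measure \<kappa>.emeasure_eq_measure)
    finally show "emeasure (distr (density N (indicator A)) M Y) S = emeasure \<kappa> S" .
  qed (simp add: \<kappa>)
  then have "(\<integral>x. f x \<partial>\<kappa>) = (\<integral>x. f x \<partial>distr (density N (indicator A)) M Y)" by simp
  also have "\<dots> = (\<integral>\<omega>. f (Y \<omega>) \<partial>density N (indicator A))"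
    using f by (intro integral_distr) auto
  also have "density N (indicator A) = density N (\<lambda>\<omega>. ennreal (indicator A \<omega>))"
    by (intro arg_cong[where f = "density N"]) (simp add: fun_eq_iff ennreal_indicator)
  also have "(\<integral>\<omega>. f (Y \<omega>) \<partial>density N (\<lambda>\<omega>. ennreal (indicator A \<omega>))) = (\<integral>\<omega>. indicator A \<omega> * f (Y \<omega>) \<partial>N)"
    using f by (subst integral_density) auto
  finally show ?thesis by simp
qed

locale markov_chain_law = bounded_kernel +
  fixes N :: "'w measure" and \<mu> :: "'a measure" and X :: "nat \<Rightarrow> 'w \<Rightarrow> 'a"
  assumes chain: "markov_chain N M P \<mu> X"
begin

sublocale prob_space N
  using chain by (simp add: markov_chain_def)

lemma X_measurable [measurable]: "X n \<in> N \<rightarrow>\<^sub>M M"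
  using chain by (simp add: markov_chain_def)

lemma space_M_nonempty: "space M \<noteq> {}"
  using measurable_space[OF X_measurable] not_empty by (metis equals0D ex_in_conv)

lemma space_history [simp]: "space (history N M X n) = space N"
  by (simp add: history_def)

lemma X_history_measurable:
  assumes "i \<le> n"
  shows "X i \<in> history N M X n \<rightarrow>\<^sub>M M"
proof -
  have "(\<lambda>\<omega>. \<lambda>i\<in>{..n}. X i \<omega>) \<in> N \<rightarrow>\<^sub>M PiM {..n} (\<lambda>_. M)"
    by (intro measurable_restrict X_measurable)
  then have "(\<lambda>\<omega>. \<lambda>i\<in>{..n}. X i \<omega>) \<in> history N M X n \<rightarrow>\<^sub>M PiM {..n} (\<lambda>_. M)"
    unfolding history_def by (intro measurable_vimage_algebra1) (rule Pi_I[OF measurable_space])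
  from measurable_compose[OF this measurable_component_singleton[of i]] assms show ?thesis by simp
qed

lemma sets_history_subset:
  assumes "space K = space N" "\<And>i. i \<le> n \<Longrightarrow> X i \<in> K \<rightarrow>\<^sub>M M"
  shows "sets (history N M X n) \<subseteq> sets K"
  unfolding history_def using assms by (intro sets_image_in_sets measurable_restrict) auto

lemma history_mono: "m \<le> n \<Longrightarrow> sets (history N M X m) \<subseteq> sets (history N M X n)"
  by (intro sets_history_subset X_history_measurable) auto

lemma history_sub: "sets (history N M X n) \<subseteq> sets N"
  by (intro sets_history_subset) auto

lemma history_subalgebra: "sigma_finite_subalgebra N (history N M X n)"
  using history_sub finite_measure_axioms
  by (intro finite_measure_subalgebra_is_sigma_finite)
    (simp add: finite_measure_subalgebra_def finite_measure_subalgebra_axioms_def subalgebra_def)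

lemma integrable_indicator_X:
  assumes A: "A \<in> sets N" and f: "f \<in> bounded_measurable M"
  shows "integrable N (\<lambda>\<omega>. indicator A \<omega> * f (X n \<omega>))"
proof -
  from f obtain B where [measurable]: "f \<in> borel_measurable M" and B: "0 \<le> B" "\<And>x. x \<in> space M \<Longrightarrow> \<bar>f x\<bar> \<le> B"
    by (elim bounded_measurableE) blast
  show ?thesis using A B measurable_space[OF X_measurable[of n]]
    by (intro integrable_const_bound[where B = B]) (auto simp: indicator_def)
qed

text \<open>
  On an event \<open>A\<close> of the history, the law of the next state is the law of the present state moved by one
  step of \<open>P\<close>; the defining property of a Markov chain checks this set by set.
\<close>

lemma markov_one_step:
  assumes A: "A \<in> sets (history N M X n)" and f: "f \<in> bounded_measurable M"
  shows "(\<integral>\<omega>. indicator A \<omega> * f (X (Suc n) \<omega>) \<partial>N) = (\<integral>\<omega>. indicator A \<omega> * kernel_op P f (X n \<omega>) \<partial>N)"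
proof -
  interpret H: sigma_finite_subalgebra N "history N M X n" by (rule history_subalgebra)
  have AN [measurable]: "A \<in> sets N" using A history_sub by blast
  define K where "K = distr (density N (\<lambda>\<omega>. ennreal (indicator A \<omega>))) M (X n)"
  have fin: "finite_measure K"
    unfolding K_def by (intro finite_measure.finite_measure_distr finite_measureI)
      (auto simp: emeasure_density nn_integral_indicator ennreal_indicator cong: nn_integral_cong)
  have PK: "P \<in> K \<rightarrow>\<^sub>M subprob_algebra M"
    using measurable_prob_algebraD[OF kernel] by (simp add: K_def)
  have spK: "space K = space M" by (simp add: K_def)
  have integral_K: "(\<integral>x. g x \<partial>K) = (\<integral>\<omega>. indicator A \<omega> * g (X n \<omega>) \<partial>N)"
    if "g \<in> bounded_measurable M" for g
    unfolding K_def using bounded_measurableD[OF that] by (simp add: integral_distr integral_density)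
  have bind: "(\<integral>x. g x \<partial>(K \<bind> P)) = (\<integral>\<omega>. indicator A \<omega> * kernel_op P g (X n \<omega>) \<partial>N)"
    if g: "g \<in> bounded_measurable M" for g
  proof -
    obtain B where "g \<in> borel_measurable M" "\<And>x. x \<in> space M \<Longrightarrow> \<bar>g x\<bar> \<le> B"
      using g by (elim bounded_measurableE) blast
    then have "(\<integral>x. g x \<partial>(K \<bind> P)) = (\<integral>x. kernel_op P g x \<partial>K)"
      unfolding kernel_op_def
      using in_space_prob_algebra[OF measurable_space[OF kernel]] kernel_sets
      by (intro integral_bind[where K = M and B' = 1] PK fin AE_I2)
        (auto simp: spK prob_space.emeasure_space_1[OF kernel_prob])
    also have "\<dots> = (\<integral>\<omega>. indicator A \<omega> * kernel_op P g (X n \<omega>) \<partial>N)"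
      using g by (intro integral_K bounded_measurable_kernel_op)
    finally show ?thesis .
  qed
  have sets_bind: "sets (K \<bind> P) = sets M"
    using kernel_sets space_M_nonempty by (intro sets_bind) (auto simp: spK)
  have "(\<integral>\<omega>. indicator A \<omega> * f (X (Suc n) \<omega>) \<partial>N) = (\<integral>x. f x \<partial>(K \<bind> P))"
  proof (rule integral_eq_of_measure_eq)
    have "emeasure (K \<bind> P) (space M) = (\<integral>\<^sup>+x. emeasure (P x) (space M) \<partial>K)"
      using space_M_nonempty by (intro emeasure_bind[where N = M] PK) (auto simp: spK)
    also have "\<dots> = (\<integral>\<^sup>+x. 1 \<partial>K)"
      using in_space_prob_algebra[OF measurable_space[OF kernel]] by (intro nn_integral_cong) (simp add: spK)
    also have "\<dots> < \<infinity>"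
      using finite_measure.emeasure_finite[OF fin] by (simp add: less_top[symmetric])
    finally show "finite_measure (K \<bind> P)"
      by (intro finite_measureI) (simp add: sets_eq_imp_space_eq[OF sets_bind])
    fix S assume S [measurable]: "S \<in> sets M"
    let ?E = "{\<omega> \<in> space N. X (Suc n) \<omega> \<in> S}"
    have "measure N {\<omega> \<in> A. X (Suc n) \<omega> \<in> S} = measure N (A \<inter> ?E)"
      using sets.sets_into_space[OF AN] by (intro arg_cong[where f = "measure N"]) auto
    also have "\<dots> = (\<integral>\<omega>\<in>A. indicator ?E \<omega> \<partial>N)"
      by (simp add: set_lebesgue_integral_def flip: indicator_inter_arith)
    also have "\<dots> = (\<integral>\<omega>\<in>A. real_cond_exp N (history N M X n) (indicator ?E) \<omega> \<partial>N)"
      using A by (intro H.real_cond_exp_intA) (auto simp: less_top[symmetric])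
    also have "\<dots> = (\<integral>\<omega>\<in>A. measure (P (X n \<omega>)) S \<partial>N)"
    proof -
      have "AE \<omega> in N. real_cond_exp N (history N M X n) (indicator ?E) \<omega> = measure (P (X n \<omega>)) S"
        using chain S by (simp add: markov_chain_def cond_prob_given_def)
      moreover have "(\<lambda>\<omega>. measure (P (X n \<omega>)) S) \<in> borel_measurable N"
        using measurable_compose[OF measurable_compose[OF X_measurable kernel] measurable_measure_prob_algebra[OF S]] .
      ultimately show ?thesis
        unfolding set_lebesgue_integral_def by (intro integral_cong_AE) auto
    qed
    also have "\<dots> = (\<integral>\<omega>. indicator A \<omega> * kernel_op P (indicator S) (X n \<omega>) \<partial>N)"
      unfolding set_lebesgue_integral_def kernel_op_def
      using measurable_space[OF X_measurable[of n]] sets.sets_into_space[OF S]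
      by (intro Bochner_Integration.integral_cong)
        (auto simp: sets_eq_imp_space_eq[OF kernel_sets] Int_absorb2 Int_absorb1)
    also have "\<dots> = measure (K \<bind> P) S"
      using bind[OF bounded_measurable_indicator[OF S]] sets.sets_into_space[OF S]
      by (simp add: sets_eq_imp_space_eq[OF sets_bind] Int_absorb2)
    finally show "measure N {\<omega> \<in> A. X (Suc n) \<omega> \<in> S} = measure (K \<bind> P) S" .
  qed (use prob_space_axioms AN sets_bind bounded_measurableD[OF f] in auto)
  then show ?thesis by (simp add: bind[OF f])
qed

lemma markov_steps:
  assumes A: "A \<in> sets (history N M X n)" and f: "f \<in> bounded_measurable M"
  shows "(\<integral>\<omega>. indicator A \<omega> * f (X (n + k) \<omega>) \<partial>N) = (\<integral>\<omega>. indicator A \<omega> * (kernel_op P ^^ k) f (X n \<omega>) \<partial>N)"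
  using f
proof (induction k arbitrary: f)
  case (Suc k)
  have "A \<in> sets (history N M X (n + k))" using A history_mono[of n "n + k"] by auto
  with Suc show ?case
    by (simp add: markov_one_step bounded_measurable_kernel_op funpow_swap1)
qed simp

lemma prob_X:
  assumes S: "S \<in> sets M"
  shows "prob {\<omega> \<in> space N. X n \<omega> \<in> S} = (\<integral>x. (kernel_op P ^^ n) (indicator S) x \<partial>\<mu>)"
proof -
  let ?f = "(kernel_op P ^^ n) (indicator S)"
  have f: "?f \<in> borel_measurable M"
    by (intro bounded_measurableD bounded_measurable_kernel_iter bounded_measurable_indicator S)
  have "space N \<in> sets (history N M X 0)" using sets.top[of "history N M X 0"] by simp
  from markov_steps[OF this bounded_measurable_indicator[OF S], of n]
  have "(\<integral>\<omega>. indicator (space N) \<omega> * indicator S (X n \<omega>) \<partial>N) = (\<integral>\<omega>. indicator (space N) \<omega> * ?f (X 0 \<omega>) \<partial>N)"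
    by simp
  also have "\<dots> = (\<integral>\<omega>. ?f (X 0 \<omega>) \<partial>N)" by (intro Bochner_Integration.integral_cong) auto
  also have "\<dots> = (\<integral>x. ?f x \<partial>distr N M (X 0))" using f by (intro integral_distr[symmetric]) auto
  also have "distr N M (X 0) = \<mu>" using chain by (simp add: markov_chain_def)
  also have "(\<integral>\<omega>. indicator (space N) \<omega> * indicator S (X n \<omega>) \<partial>N :: real)
      = (\<integral>\<omega>. indicator {\<omega> \<in> space N. X n \<omega> \<in> S} \<omega> \<partial>N)"
    by (intro Bochner_Integration.integral_cong) (auto simp: indicator_def)
  also have "\<dots> = prob {\<omega> \<in> space N. X n \<omega> \<in> S}" by (simp add: Int_absorb2)
  finally show ?thesis .
qed

lemma cond_prob_future:
  assumes S [measurable]: "S \<in> sets M"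
  shows "AE \<omega> in N. cond_prob_given N (history N M X n) {\<omega> \<in> space N. X (n + k) \<omega> \<in> S} \<omega>
    = (kernel_op P ^^ k) (indicator S) (X n \<omega>)"
  unfolding cond_prob_given_def
proof (rule sigma_finite_subalgebra.real_cond_exp_charact[OF history_subalgebra])
  have S': "indicator S \<in> bounded_measurable M" by (intro bounded_measurable_indicator S)
  then have f: "(kernel_op P ^^ k) (indicator S) \<in> bounded_measurable M" by (rule bounded_measurable_kernel_iter)
  show "integrable N (indicator {\<omega> \<in> space N. X (n + k) \<omega> \<in> S} :: 'w \<Rightarrow> real)"
    by (auto simp: less_top[symmetric])
  have "integrable N (\<lambda>\<omega>. indicator (space N) \<omega> * (kernel_op P ^^ k) (indicator S) (X n \<omega>))"
    using f by (intro integrable_indicator_X) auto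
  then show "integrable N (\<lambda>\<omega>. (kernel_op P ^^ k) (indicator S) (X n \<omega>))"
    by (rule Bochner_Integration.integrable_cong[THEN iffD1, rotated -1]) auto
  show "(\<lambda>\<omega>. (kernel_op P ^^ k) (indicator S) (X n \<omega>)) \<in> borel_measurable (history N M X n)"
    using measurable_compose[OF X_history_measurable[OF order_refl] bounded_measurableD[OF f]] .
  fix A assume A: "A \<in> sets (history N M X n)"
  have "(\<integral>\<omega>\<in>A. indicator {\<omega> \<in> space N. X (n + k) \<omega> \<in> S} \<omega> \<partial>N)
      = (\<integral>\<omega>. indicator A \<omega> * indicator S (X (n + k) \<omega>) \<partial>N :: real)"
    unfolding set_lebesgue_integral_def by (intro Bochner_Integration.integral_cong) (auto simp: indicator_def)
  then show "(\<integral>\<omega>\<in>A. indicator {\<omega> \<in> space N. X (n + k) \<omega> \<in> S} \<omega> \<partial>N)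
      = (\<integral>\<omega>\<in>A. (kernel_op P ^^ k) (indicator S) (X n \<omega>) \<partial>N)"
    using markov_steps[OF A S', of k] by (simp add: set_lebesgue_integral_def)
qed

text \<open>
  Given the history up to time \<open>n\<close>, the event \<open>T = n\<close> is independent of the future, and a future event
  at time \<open>n + k\<close> has the conditional probability \<open>P\<^sup>k 1\<^sub>S (X\<^sub>n)\<close>.  For \<open>k = 0\<close> the state is part of the
  history and conditional independence is silent, but then the equation is trivial.
\<close>

lemma stopping_time_markov:
  assumes T: "randomized_stopping_time N M X T" and S [measurable]: "S \<in> sets M"
  shows "prob {\<omega> \<in> space N. T \<omega> = enat n \<and> X (n + k) \<omega> \<in> S}
    = (\<integral>\<omega>. indicator {\<omega> \<in> space N. T \<omega> = enat n} \<omega> * (kernel_op P ^^ k) (indicator S) (X n \<omega>) \<partial>N)"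
proof -
  interpret H: sigma_finite_subalgebra N "history N M X n" by (rule history_subalgebra)
  have [measurable]: "T \<in> N \<rightarrow>\<^sub>M count_space UNIV" using T by (simp add: randomized_stopping_time_def)
  define A where "A = {\<omega> \<in> space N. T \<omega> = enat n}"
  define E where "E = {\<omega> \<in> space N. X (n + k) \<omega> \<in> S}"
  have [measurable]: "A \<in> sets N" "E \<in> sets N" by (simp_all add: A_def E_def)
  have AE_eq: "A \<inter> E = {\<omega> \<in> space N. T \<omega> = enat n \<and> X (n + k) \<omega> \<in> S}" by (auto simp: A_def E_def)
  show ?thesis
  proof (cases k)
    case 0
    have "prob (A \<inter> E) = (\<integral>\<omega>. indicator (A \<inter> E) \<omega> \<partial>N)" by simp
    also have "\<dots> = (\<integral>\<omega>. indicator A \<omega> * (kernel_op P ^^ k) (indicator S) (X n \<omega>) \<partial>N)"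
      by (intro Bochner_Integration.integral_cong) (auto simp: 0 E_def indicator_def)
    finally show ?thesis unfolding AE_eq[symmetric] unfolding A_def[symmetric] .
  next
    case (Suc j)
    let ?f = "(kernel_op P ^^ k) (indicator S)"
    have f: "?f \<in> bounded_measurable M"
      by (intro bounded_measurable_kernel_iter bounded_measurable_indicator S)
    let ?B = "{y \<in> space (PiM UNIV (\<lambda>_::nat. M)). y j \<in> S}"
    have "?B \<in> sets (PiM UNIV (\<lambda>_. M))" by measurable
    moreover have "{\<omega> \<in> space N. (\<lambda>i. X (Suc n + i) \<omega>) \<in> ?B} = E"
      using measurable_space[OF X_measurable] by (auto simp: E_def Suc space_PiM)
    moreover have "\<forall>B\<in>sets (PiM UNIV (\<lambda>_. M)). cond_indep_events N (history N M X n) A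
        {\<omega> \<in> space N. (\<lambda>i. X (Suc n + i) \<omega>) \<in> B}"
      using T unfolding randomized_stopping_time_def A_def by blast
    ultimately have "cond_indep_events N (history N M X n) A E"
      by (auto dest: bspec[where x = ?B])
    with cond_prob_future[OF S, of n k]
    have ae: "AE \<omega> in N. real_cond_exp N (history N M X n) (indicator (A \<inter> E)) \<omega>
        = ?f (X n \<omega>) * real_cond_exp N (history N M X n) (indicator A) \<omega>"
      unfolding cond_indep_events_def cond_prob_given_def E_def[symmetric]
      by eventually_elim (simp add: mult.commute)
    have fX: "(\<lambda>\<omega>. ?f (X n \<omega>)) \<in> borel_measurable (history N M X n)"
      using measurable_compose[OF X_history_measurable[OF order_refl] bounded_measurableD[OF f]] .
    then have fXN [measurable]: "(\<lambda>\<omega>. ?f (X n \<omega>)) \<in> borel_measurable N"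
      by (rule measurable_from_subalg[OF H.subalg])
    have "prob (A \<inter> E) = (\<integral>\<omega>. indicator (A \<inter> E) \<omega> \<partial>N)" by simp
    also have "\<dots> = (\<integral>\<omega>. real_cond_exp N (history N M X n) (indicator (A \<inter> E)) \<omega> \<partial>N)"
      by (intro H.real_cond_exp_int(2)[symmetric]) (auto simp: less_top[symmetric])
    also have "\<dots> = (\<integral>\<omega>. ?f (X n \<omega>) * real_cond_exp N (history N M X n) (indicator A) \<omega> \<partial>N)"
      using ae by (intro integral_cong_AE) auto
    also have "\<dots> = (\<integral>\<omega>. ?f (X n \<omega>) * indicator A \<omega> \<partial>N)"
      using integrable_indicator_X[OF \<open>A \<in> sets N\<close> f, of n] fX
      by (intro H.real_cond_exp_intg) (auto simp: mult.commute)
    finally show ?thesis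
      unfolding AE_eq[symmetric] unfolding A_def[symmetric] by (simp add: mult.commute)
  qed
qed

text \<open>
  Split according to the value of \<open>T\<close>.  On \<open>T = n\<close> the state \<open>X\<^sub>n\<close> has law \<open>\<nu>\<close>, and from there the chain
  runs freely for the remaining \<open>t - n\<close> steps.
\<close>

lemma strong_time_decomposition:
  assumes T: "randomized_stopping_time N M X T" and \<nu>: "\<nu> \<in> space (prob_algebra M)"
    and strong: "\<And>n S. S \<in> sets M \<Longrightarrow> \<P>(\<omega> in N. T \<omega> = enat n) \<noteq> 0 \<Longrightarrow>
      \<P>(\<omega> in N. X n \<omega> \<in> S \<bar> T \<omega> = enat n) = measure \<nu> S"
    and S [measurable]: "S \<in> sets M"
  shows "prob {\<omega> \<in> space N. X t \<omega> \<in> S} = prob {\<omega> \<in> space N. enat t < T \<omega> \<and> X t \<omega> \<in> S}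
    + (\<Sum>n\<le>t. prob {\<omega> \<in> space N. T \<omega> = enat n} * (\<integral>x. (kernel_op P ^^ (t - n)) (indicator S) x \<partial>\<nu>))"
proof -
  have [measurable]: "T \<in> N \<rightarrow>\<^sub>M count_space UNIV" using T by (simp add: randomized_stopping_time_def)
  have \<nu>_sets: "sets \<nu> = sets M" and "prob_space \<nu>" using \<nu> by (auto simp: space_prob_algebra)
  interpret \<nu>: prob_space \<nu> by fact
  let ?A = "\<lambda>n. {\<omega> \<in> space N. T \<omega> = enat n}"
  have at_T: "prob {\<omega> \<in> space N. T \<omega> = enat n \<and> X t \<omega> \<in> S}
      = prob (?A n) * (\<integral>x. (kernel_op P ^^ (t - n)) (indicator S) x \<partial>\<nu>)" if "n \<le> t" for n
  proof -
    let ?f = "(kernel_op P ^^ (t - n)) (indicator S)"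
    have f: "?f \<in> borel_measurable M"
      by (intro bounded_measurableD bounded_measurable_kernel_iter bounded_measurable_indicator S)
    have "(\<integral>\<omega>. indicator (?A n) \<omega> * ?f (X n \<omega>) \<partial>N) = (\<integral>x. ?f x \<partial>density \<nu> (\<lambda>_. ennreal (prob (?A n))))"
    proof (rule integral_eq_of_measure_eq)
      fix S' assume S [measurable]: "S' \<in> sets M"
      have "measure N {\<omega> \<in> ?A n. X n \<omega> \<in> S'} = prob (?A n) * measure \<nu> S'"
      proof (cases "prob (?A n) = 0")
        case True
        have "prob {\<omega> \<in> ?A n. X n \<omega> \<in> S'} \<le> prob (?A n)" by (intro finite_measure_mono) auto
        with True have "prob {\<omega> \<in> ?A n. X n \<omega> \<in> S'} = 0" by (simp add: measure_le_0_iff)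
        with True show ?thesis by simp
      next
        case False
        have *: "{\<omega> \<in> ?A n. X n \<omega> \<in> S'} = {\<omega> \<in> space N. X n \<omega> \<in> S' \<and> T \<omega> = enat n}" by auto
        from strong[OF S False] False show ?thesis unfolding * by (simp add: cond_prob_def field_simps)
      qed
      then show "measure N {\<omega> \<in> ?A n. X n \<omega> \<in> S'} = measure (density \<nu> (\<lambda>_. ennreal (prob (?A n)))) S'"
        using S by (simp add: measure_density_const \<nu>_sets)
    qed (use prob_space_axioms f \<nu>_sets in \<open>auto simp: emeasure_density \<nu>.emeasure_space_1 intro!: finite_measureI\<close>)
    also have "\<dots> = prob (?A n) * (\<integral>x. ?f x \<partial>\<nu>)"
      using f by (subst integral_density) (auto simp: measurable_cong_sets[OF \<nu>_sets refl])
    finally show ?thesis using stopping_time_markov[OF T S, of n "t - n"] that by simp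
  qed
  have "{\<omega> \<in> space N. X t \<omega> \<in> S} = {\<omega> \<in> space N. enat t < T \<omega> \<and> X t \<omega> \<in> S} \<union>
      (\<Union>n\<le>t. {\<omega> \<in> space N. T \<omega> = enat n \<and> X t \<omega> \<in> S})" (is "_ = ?later \<union> ?early")
  proof safe
    fix \<omega> assume "\<omega> \<notin> ?early" "\<omega> \<in> space N" "X t \<omega> \<in> S"
    then show "enat t < T \<omega>"
    proof (cases "T \<omega>")
      case (enat n)
      with \<open>\<omega> \<notin> ?early\<close> \<open>\<omega> \<in> space N\<close> \<open>X t \<omega> \<in> S\<close> have "\<not> n \<le> t" by auto
      with enat show ?thesis by simp
    qed simp
  qed
  then have "prob {\<omega> \<in> space N. X t \<omega> \<in> S} = prob (?later \<union> ?early)" by simp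
  also have "\<dots> = prob ?later + prob ?early"
    by (intro finite_measure_Union) auto
  also have "prob ?early = (\<Sum>n\<le>t. prob {\<omega> \<in> space N. T \<omega> = enat n \<and> X t \<omega> \<in> S})"
    by (intro finite_measure_finite_Union) (auto simp: disjoint_family_on_def)
  finally show ?thesis by (simp add: at_T)
qed

end

lemma (in prob_space) random_time_tail:
  fixes T :: "'a \<Rightarrow> enat"
  assumes T [measurable]: "T \<in> M \<rightarrow>\<^sub>M count_space UNIV"
  shows "\<P>(\<omega> in M. T \<omega> = enat 0) = 1 - \<P>(\<omega> in M. enat 0 < T \<omega>)"
    and "\<P>(\<omega> in M. T \<omega> = enat (Suc n)) = \<P>(\<omega> in M. enat n < T \<omega>) - \<P>(\<omega> in M. enat (Suc n) < T \<omega>)"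
    and "(\<lambda>n. \<P>(\<omega> in M. T \<omega> = enat n)) sums \<P>(\<omega> in M. T \<omega> < \<infinity>)"
proof -
  have "{\<omega> \<in> space M. T \<omega> = enat 0} = space M - {\<omega> \<in> space M. enat 0 < T \<omega>}"
    by (auto simp: zero_enat_def[symmetric])
  then show "\<P>(\<omega> in M. T \<omega> = enat 0) = 1 - \<P>(\<omega> in M. enat 0 < T \<omega>)"
    by (simp add: prob_compl)
  have "{\<omega> \<in> space M. T \<omega> = enat (Suc n)}
      = {\<omega> \<in> space M. enat n < T \<omega>} - {\<omega> \<in> space M. enat (Suc n) < T \<omega>}" (is "_ = ?a - ?b")
  proof -
    have "s = enat (Suc n) \<longleftrightarrow> enat n < s \<and> \<not> enat (Suc n) < s" for s by (cases s) auto
    then show ?thesis by auto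
  qed
  moreover have "?b \<subseteq> ?a"
  proof safe
    fix \<omega> assume "enat (Suc n) < T \<omega>"
    then show "enat n < T \<omega>" by (cases "T \<omega>") auto
  qed
  ultimately show "\<P>(\<omega> in M. T \<omega> = enat (Suc n)) = \<P>(\<omega> in M. enat n < T \<omega>) - \<P>(\<omega> in M. enat (Suc n) < T \<omega>)"
    by (simp add: finite_measure_Diff)
  have "(\<lambda>n. \<P>(\<omega> in M. T \<omega> = enat n)) sums prob (\<Union>n. {\<omega> \<in> space M. T \<omega> = enat n})"
    by (rule finite_measure_UNION) (auto simp: disjoint_family_on_def)
  moreover have "(\<Union>n. {\<omega> \<in> space M. T \<omega> = enat n}) = {\<omega> \<in> space M. T \<omega> < \<infinity>}"
    by auto
  ultimately show "(\<lambda>n. \<P>(\<omega> in M. T \<omega> = enat n)) sums \<P>(\<omega> in M. T \<omega> < \<infinity>)" by simp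
qed

section \<open>Densities and total variation distance\<close>

context reversible_kernel
begin

text \<open>
  The Radon-Nikodym derivative exceeds \<open>m\<close> on a null set only, since otherwise the domination
  would fail for the set where it does.  It is cut off at \<open>m\<close> to obtain a function that is bounded everywhere.
\<close>

lemma bounded_density:
  assumes \<nu>: "\<nu> \<in> space (prob_algebra M)"
    and dom: "\<And>S. S \<in> sets M \<Longrightarrow> measure \<nu> S \<le> m * measure \<pi> S"
  obtains f where "f \<in> bounded_measurable M" "\<And>x. 0 \<le> f x" "\<And>x. f x \<le> m"
    "\<And>g. g \<in> bounded_measurable M \<Longrightarrow> (\<integral>x. g x \<partial>\<nu>) = L2_inner \<pi> f g"
proof -
  interpret \<pi>: prob_space \<pi> by (rule pi_prob)
  have \<nu>_sets: "sets \<nu> = sets \<pi>" and "prob_space \<nu>" using \<nu> pi_sets by (auto simp: space_prob_algebra)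
  interpret \<nu>: prob_space \<nu> by fact
  have "1 \<le> m"
    using dom[of "space M"] \<pi>.prob_space \<nu>.prob_space sets_eq_imp_space_eq[OF \<nu>_sets] by (simp add: pi_space)
  then have m: "0 \<le> m" by simp
  define r where "r = RN_deriv \<pi> \<nu>"
  have r [measurable]: "r \<in> borel_measurable \<pi>" by (simp add: r_def)
  have "absolutely_continuous \<pi> \<nu>"
  proof (unfold absolutely_continuous_def, safe)
    fix S assume S: "S \<in> null_sets \<pi>"
    then have "measure \<nu> S \<le> 0"
      using dom[of S] by (simp add: measure_eq_0_null_sets pi_sets[symmetric] null_setsD2)
    with S show "S \<in> null_sets \<nu>"
      by (auto simp: null_sets_def \<nu>_sets \<nu>.emeasure_eq_measure measure_le_0_iff)
  qed
  then have \<nu>_density: "\<nu> = density \<pi> r"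
    unfolding r_def using \<nu>_sets by (simp add: \<pi>.density_RN_deriv)
  have ae: "AE x in \<pi>. r x \<le> ennreal m"
  proof -
    define S where "S = {x \<in> space \<pi>. ennreal m < r x}"
    have S [measurable]: "S \<in> sets \<pi>" by (simp add: S_def)
    have r_S: "(\<integral>\<^sup>+x. r x * indicator S x \<partial>\<pi>) = emeasure \<nu> S"
      by (simp add: \<nu>_density emeasure_density)
    have "(\<integral>\<^sup>+x. (r x - ennreal m) * indicator S x \<partial>\<pi>)
        = (\<integral>\<^sup>+x. r x * indicator S x - ennreal m * indicator S x \<partial>\<pi>)"
      by (intro nn_integral_cong) (auto simp: indicator_def)
    also have "\<dots> = (\<integral>\<^sup>+x. r x * indicator S x \<partial>\<pi>) - (\<integral>\<^sup>+x. ennreal m * indicator S x \<partial>\<pi>)"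
    proof (rule nn_integral_diff)
      show "(\<integral>\<^sup>+x. ennreal m * indicator S x \<partial>\<pi>) \<noteq> \<infinity>"
        by (simp add: nn_integral_cmult_indicator ennreal_mult_eq_top_iff)
      show "AE x in \<pi>. ennreal m * indicator S x \<le> r x * indicator S x"
        by (intro AE_I2) (auto simp: S_def indicator_def)
    qed simp_all
    also have "\<dots> = 0"
      using dom[of S] m
      by (simp add: r_S nn_integral_cmult_indicator \<nu>.emeasure_eq_measure \<pi>.emeasure_eq_measure pi_sets[symmetric]
          diff_eq_0_iff_ennreal ennreal_leI flip: ennreal_mult)
    finally have "AE x in \<pi>. (r x - ennreal m) * indicator S x = 0"
      by (subst (asm) nn_integral_0_iff_AE) auto
    then show ?thesis
      by (rule AE_mp) (auto intro!: AE_I2 simp: S_def indicator_def diff_eq_0_iff_ennreal not_less split: if_splits)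
  qed
  define f where "f x = min m (enn2real (r x))" for x
  have f_meas: "f \<in> borel_measurable \<pi>" unfolding f_def[abs_def] by measurable
  have f_bounds: "0 \<le> f x" "f x \<le> m" for x using m by (simp_all add: f_def)
  have f_bd: "f \<in> bounded_measurable M"
    using f_meas f_bounds by (intro bounded_measurableI[where B = m]) (auto simp: measurable_cong_sets[OF pi_sets refl])
  have "AE x in \<pi>. r x = ennreal (f x)"
    using ae
  proof eventually_elim
    case (elim x)
    then have "r x < \<top>" by (rule order_le_less_trans) simp
    then have "r x = ennreal (enn2real (r x))" by simp
    moreover have "enn2real (r x) \<le> m" using elim m by (intro enn2real_leI)
    ultimately show ?case by (simp add: f_def min_absorb2)
  qed
  then have \<nu>_f: "\<nu> = density \<pi> (\<lambda>x. ennreal (f x))"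
    unfolding \<nu>_density using r f_meas by (intro density_cong) auto
  have "(\<integral>x. g x \<partial>\<nu>) = L2_inner \<pi> f g" if "g \<in> bounded_measurable M" for g
    using bounded_measurableD[OF that] f_meas f_bounds unfolding \<nu>_f L2_inner_def
    by (subst integral_density) (auto simp: measurable_cong_sets[OF pi_sets refl])
  with that f_bd f_bounds show thesis by blast
qed

text \<open>
  Test with the set on which \<open>h\<close> is positive: there \<open>h f \<le> m h\<close>, elsewhere \<open>h f \<le> 0\<close>.
\<close>

lemma L2_inner_nonpos:
  assumes h: "h \<in> bounded_measurable M" and f: "f \<in> bounded_measurable M"
    and f_bounds: "\<And>x. 0 \<le> f x" "\<And>x. f x \<le> m"
    and neg: "\<And>S. S \<in> sets M \<Longrightarrow> L2_inner \<pi> h (indicator S) \<le> 0"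
  shows "L2_inner \<pi> h f \<le> 0"
proof -
  define S where "S = {x \<in> space M. 0 < h x}"
  have S: "S \<in> sets M" using bounded_measurableD[OF h] by (simp add: S_def)
  have "L2_inner \<pi> h f \<le> (\<integral>x. m * (h x * indicator S x) \<partial>\<pi>)"
    unfolding L2_inner_def
  proof (intro integral_mono pi_integrable bounded_measurable_intros h f S)
    fix x assume "x \<in> space \<pi>"
    then show "h x * f x \<le> m * (h x * indicator S x)"
      using f_bounds[of x] mult_left_mono[of "f x" m "h x"]
      by (auto simp: S_def pi_space indicator_def mult.commute[of "h x"] mult_nonneg_nonpos not_less)
  qed
  also have "\<dots> = m * L2_inner \<pi> h (indicator S)" by (simp add: L2_inner_def)
  also have "\<dots> \<le> 0"
    using neg[OF S] order_trans[OF f_bounds(1,2)] by (simp add: mult_nonneg_nonpos)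
  finally show ?thesis .
qed

text \<open>
  Here \<open>G\<close> plays the role of the tail of the renewal time, and \<open>dom\<close> says that the convolution of \<open>G\<close> with
  the laws \<open>\<nu>P\<^sup>k\<close> stays below \<open>m\<pi>\<close>.  Against the density \<open>f\<close> of \<open>\<nu>\<close>, this bounds the convolution of \<open>G\<close>
  with the decreasing sequence \<open>u n = \<langle>f, P\<^sup>nf\<rangle>\<close> by \<open>m\<close>, which forces \<open>u n - 1 \<le> m - \<Sum>\<^bsub>k\<le>n\<^esub> G k\<close>.
  The left side at \<open>n = 2t\<close> is the squared distance of the density \<open>P\<^sup>tf\<close> of \<open>\<nu>P\<^sup>t\<close> from \<open>1\<close>.
\<close>

lemma total_variation_from_dominating_sums:
  fixes G :: "nat \<Rightarrow> real"
  assumes nonneg: "nonneg_eigenvalues P \<pi>" and \<nu>: "\<nu> \<in> space (prob_algebra M)"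
    and G: "\<And>k. 0 \<le> G k" "G 0 = 1" "\<And>n. (\<Sum>k\<le>n. G k) \<le> m"
    and dom: "\<And>n S. S \<in> sets M \<Longrightarrow>
      (\<Sum>k\<le>n. G k * (\<integral>x. (kernel_op P ^^ (n - k)) (indicator S) x \<partial>\<nu>)) \<le> m * measure \<pi> S"
    and S: "S \<in> sets M"
  shows "\<bar>(\<integral>x. (kernel_op P ^^ t) (indicator S) x \<partial>\<nu>) - measure \<pi> S\<bar> \<le> 1 / 2 * sqrt (m - (\<Sum>k\<le>2 * t. G k))"
proof -
  interpret \<pi>: prob_space \<pi> by (rule pi_prob)
  have \<nu>_sets: "sets \<nu> = sets M" and "prob_space \<nu>" using \<nu> by (auto simp: space_prob_algebra)
  interpret \<nu>: prob_space \<nu> by fact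
  have measure_\<nu>: "(\<integral>x. indicator S x \<partial>\<nu>) = measure \<nu> S" if "S \<in> sets M" for S
    using that sets.sets_into_space[OF that] by (simp add: sets_eq_imp_space_eq[OF \<nu>_sets] Int_absorb2)
  have measure_\<pi>: "(\<integral>x. indicator S x \<partial>\<pi>) = measure \<pi> S" if "S \<in> sets M" for S
    using that sets.sets_into_space[OF that] by (simp add: pi_space Int_absorb2)
  have "measure \<nu> S \<le> m * measure \<pi> S" if "S \<in> sets M" for S
    using dom[OF that, of 0] G(2) that by (simp add: measure_\<nu> del: Bochner_Integration.integral_indicator)
  then obtain f where f: "f \<in> bounded_measurable M" and f_bounds: "\<And>x. 0 \<le> f x" "\<And>x. f x \<le> m"
    and \<nu>_f: "\<And>g. g \<in> bounded_measurable M \<Longrightarrow> (\<integral>x. g x \<partial>\<nu>) = L2_inner \<pi> f g"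
    using bounded_density[OF \<nu>] by blast
  let ?Q = "\<lambda>n. kernel_op P ^^ n"
  define u where "u n = L2_inner \<pi> f (?Q n f)" for n
  have Qf: "?Q n f \<in> bounded_measurable M" for n using f by (rule bounded_measurable_kernel_iter)
  have ind: "indicator S \<in> bounded_measurable M" if "S \<in> sets M" for S using that by (rule bounded_measurable_indicator)
  have \<nu>_Q: "(\<integral>x. ?Q n (indicator S) x \<partial>\<nu>) = L2_inner \<pi> (?Q n f) (indicator S)" if "S \<in> sets M" for n S
    using f ind[OF that] by (simp add: \<nu>_f bounded_measurable_kernel_iter kernel_iter_self_adjoint)
  have m: "0 < m" using G(3)[of 0] G(2) by simp
  have f_one: "(\<integral>x. f x \<partial>\<pi>) = 1"
    using \<nu>_f[OF bounded_measurable_const[of 1]] by (simp add: L2_inner_def \<nu>.prob_space)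
  have dec: "decseq u"
    unfolding u_def using nonneg f by (rule autocorrelation_decreasing)
  have "u 0 \<le> (\<integral>x. m * f x \<partial>\<pi>)"
    unfolding u_def L2_inner_def using f f_bounds
    by (intro integral_mono pi_integrable bounded_measurable_intros) (auto intro: mult_right_mono)
  then have u_le: "u n \<le> m" for n
    using decseqD[OF dec, of 0 n] by (simp add: f_one)
  have u_excess: "u n - 1 \<le> m - (\<Sum>k\<le>n. G k)" for n
  proof -
    \<comment> \<open>The density of \<open>w\<^sub>n - m\<pi>\<close> with respect to \<open>\<pi>\<close>.\<close>
    define h where "h x = (\<Sum>k\<le>n. G k * ?Q (n - k) f x) - m" for x
    have h: "h \<in> bounded_measurable M"
      unfolding h_def[abs_def] by (intro bounded_measurable_intros Qf)
    have inner_h: "L2_inner \<pi> h g = (\<Sum>k\<le>n. G k * L2_inner \<pi> (?Q (n - k) f) g) - m * (\<integral>x. g x \<partial>\<pi>)"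
      if g: "g \<in> bounded_measurable M" for g
    proof -
      have "L2_inner \<pi> h g = (\<integral>x. (\<Sum>k\<le>n. G k * (?Q (n - k) f x * g x)) - m * g x \<partial>\<pi>)"
        unfolding L2_inner_def h_def
        by (intro Bochner_Integration.integral_cong) (auto simp: left_diff_distrib sum_distrib_right mult.assoc)
      also have "\<dots> = (\<Sum>k\<le>n. G k * L2_inner \<pi> (?Q (n - k) f) g) - m * (\<integral>x. g x \<partial>\<pi>)"
        unfolding L2_inner_def using g Qf by (simp add: pi_integrable bounded_measurable_intros)
      finally show ?thesis .
    qed
    have "L2_inner \<pi> h f \<le> 0"
    proof (rule L2_inner_nonpos[OF h f f_bounds])
      fix S assume S: "S \<in> sets M"
      then show "L2_inner \<pi> h (indicator S) \<le> 0"
        using dom[OF S, of n] by (simp only: inner_h[OF ind] \<nu>_Q measure_\<pi>)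
    qed
    then have "(\<Sum>k\<le>n. G k * u (n - k)) \<le> m"
      by (simp add: inner_h f f_one u_def L2_inner_commute[of f])
    moreover have "(\<Sum>k\<le>n. G k) * u n \<le> (\<Sum>k\<le>n. G k * u (n - k))"
      unfolding sum_distrib_right using G(1) decseqD[OF dec] by (intro sum_mono mult_left_mono) auto
    ultimately have "(\<Sum>k\<le>n. G k) * u n \<le> m" by simp
    then have "m * (u n - 1) \<le> (m - (\<Sum>k\<le>n. G k)) * u n" by (simp add: algebra_simps)
    also have "\<dots> \<le> (m - (\<Sum>k\<le>n. G k)) * m" using u_le G(3)[of n] by (intro mult_left_mono) auto
    finally show ?thesis using m by (simp add: mult.commute)
  qed
  \<comment> \<open>As \<open>?a\<close> has mean zero, the indicator may be centred; this produces the factor \<open>1 / 2\<close>.\<close>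
  let ?a = "\<lambda>x. ?Q t f x - 1" and ?b = "\<lambda>x. indicator S x - 1 / 2 :: real"
  have a: "?a \<in> bounded_measurable M" and b: "?b \<in> bounded_measurable M"
    by (intro bounded_measurable_intros Qf ind[OF S])+
  have Qf_one: "(\<integral>x. ?Q t f x \<partial>\<pi>) = 1" using f by (simp add: integral_kernel_iter f_one)
  have ab: "L2_inner \<pi> ?a ?b = (\<integral>x. ?Q t (indicator S) x \<partial>\<nu>) - measure \<pi> S"
  proof -
    have "L2_inner \<pi> ?a ?b = (\<integral>x. ?Q t f x * indicator S x - indicator S x - (1 / 2 * ?Q t f x - 1 / 2) \<partial>\<pi>)"
      unfolding L2_inner_def by (simp add: algebra_simps)
    also have "\<dots> = L2_inner \<pi> (?Q t f) (indicator S) - (\<integral>x. indicator S x \<partial>\<pi>)"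
      unfolding L2_inner_def using Qf ind[OF S] Qf_one
      by (simp add: pi_integrable bounded_measurable_intros \<pi>.prob_space del: Bochner_Integration.integral_indicator)
    finally show ?thesis using S by (simp only: \<nu>_Q measure_\<pi>)
  qed
  have aa: "L2_inner \<pi> ?a ?a = u (2 * t) - 1"
  proof -
    have "L2_inner \<pi> ?a ?a = (\<integral>x. ?Q t f x * ?Q t f x - 2 * ?Q t f x + 1 \<partial>\<pi>)"
      unfolding L2_inner_def by (simp add: algebra_simps)
    also have "\<dots> = L2_inner \<pi> (?Q t f) (?Q t f) - 1"
      unfolding L2_inner_def using Qf Qf_one by (simp add: pi_integrable bounded_measurable_intros \<pi>.prob_space)
    also have "L2_inner \<pi> (?Q t f) (?Q t f) = u (2 * t)"
      using f Qf by (simp add: u_def mult_2 funpow_add kernel_iter_self_adjoint)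
    finally show ?thesis .
  qed
  have bb: "L2_inner \<pi> ?b ?b = 1 / 4"
  proof -
    have "L2_inner \<pi> ?b ?b = (\<integral>x. 1 / 4 \<partial>\<pi>)"
      unfolding L2_inner_def by (intro Bochner_Integration.integral_cong) (auto simp: indicator_def)
    then show ?thesis by (simp add: \<pi>.prob_space)
  qed
  have "(L2_inner \<pi> ?a ?b)\<^sup>2 \<le> (u (2 * t) - 1) * (1 / 4)"
    using L2_inner_Cauchy_Schwarz[OF a b] by (simp only: aa bb)
  also have "\<dots> \<le> (m - (\<Sum>k\<le>2 * t. G k)) / 4" using u_excess[of "2 * t"] by simp
  finally have "sqrt ((L2_inner \<pi> ?a ?b)\<^sup>2) \<le> sqrt ((m - (\<Sum>k\<le>2 * t. G k)) / 4)"
    by (rule real_sqrt_le_mono)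
  then show ?thesis by (simp add: ab real_sqrt_divide)
qed

end

section \<open>The convergence bound\<close>

theorem theorem1p3:
  fixes M :: "'a measure" and P :: "'a \<Rightarrow> 'a measure" and \<pi> \<nu> :: "'a measure"
    and \<Omega> :: "'w measure" and Pr :: "'a measure \<Rightarrow> 'w measure"
    and X :: "nat \<Rightarrow> 'w \<Rightarrow> 'a" and T :: "'w \<Rightarrow> enat"
    and x :: 'a and A\<nu> Ax \<rho> D :: real and F :: "nat \<Rightarrow> real"
  assumes kernel: "P \<in> M \<rightarrow>\<^sub>M prob_algebra M"
    and prob: "\<And>\<mu>. \<mu> \<in> space (prob_algebra M) \<Longrightarrow> Pr \<mu> \<in> space (prob_algebra \<Omega>)"
    and chain: "\<And>\<mu>. \<mu> \<in> space (prob_algebra M) \<Longrightarrow> markov_chain (Pr \<mu>) M P \<mu> X"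
    and pi: "\<pi> \<in> space (prob_algebra M)"
    and rev: "reversible_wrt M P \<pi>"
    and nonneg: "nonneg_eigenvalues P \<pi>"
    and strong: "strong_random_time Pr M X T \<nu>"
    and ge1: "\<P>(\<omega> in Pr \<nu>. T \<omega> \<ge> 1) = 1"
    and mean: "(\<integral>\<^sup>+\<omega>. ennreal_of_enat (T \<omega>) \<partial>Pr \<nu>) < \<infinity>"
    and finite_time: "\<And>\<mu>. \<mu> \<in> space (prob_algebra M) \<Longrightarrow> \<P>(\<omega> in Pr \<mu>. T \<omega> < \<infinity>) = 1"
    and x: "x \<in> space M"
    and rho: "0 < \<rho>" "\<rho> < 1"
    and tail_nu: "\<And>t::nat. \<P>(\<omega> in Pr \<nu>. T \<omega> > enat t) \<le> A\<nu> * \<rho> ^ t"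
    and tail_x: "\<And>t::nat. \<P>(\<omega> in Pr (return M x). T \<omega> > enat t) \<le> Ax * \<rho> ^ t"
    and D: "D = 1 / 2 * sqrt (A\<nu> * \<rho> / (1 - \<rho>))"
    and F: "\<And>t. F t = (1 - \<rho>) / \<rho> * D * Ax * real t + max (1 - D) 0 * Ax + D"
  shows "\<forall>t. tv_dist (distr (Pr (return M x)) M (X t)) \<pi> \<le> F t * \<rho> ^ t"
proof
  fix t
  interpret R: reversible_kernel M P \<pi> using kernel pi rev by unfold_locales
  have \<nu>: "\<nu> \<in> space (prob_algebra M)" using strong by (simp add: strong_random_time_def)
  have \<delta>: "return M x \<in> space (prob_algebra M)"
    using x by (simp add: space_prob_algebra prob_space_return)
  let ?v = "\<lambda>t S. \<integral>y. (kernel_op P ^^ t) (indicator S) y \<partial>\<nu>"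
  let ?p = "\<lambda>\<mu> n. \<P>(\<omega> in Pr \<mu>. T \<omega> = enat n)"
  let ?G = "\<lambda>\<mu> n. \<P>(\<omega> in Pr \<mu>. enat n < T \<omega>)"
  let ?e = "\<lambda>\<mu> t S. \<P>(\<omega> in Pr \<mu>. enat t < T \<omega> \<and> X t \<omega> \<in> S)"
  have law: "markov_chain_law M P (Pr \<mu>) \<mu> X" if "\<mu> \<in> space (prob_algebra M)" for \<mu>
    using kernel chain[OF that] by unfold_locales
  have decomposition: "\<P>(\<omega> in Pr \<mu>. X t \<omega> \<in> S) = ?e \<mu> t S + (\<Sum>n\<le>t. ?p \<mu> n * ?v (t - n) S)"
    if \<mu>: "\<mu> \<in> space (prob_algebra M)" and S: "S \<in> sets M" for \<mu> t S
    using strong \<mu> by (intro markov_chain_law.strong_time_decomposition[OF law] \<nu> S)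
      (auto simp: strong_random_time_def)
  have prob_X: "\<P>(\<omega> in Pr \<mu>. X t \<omega> \<in> S) = (\<integral>y. (kernel_op P ^^ t) (indicator S) y \<partial>\<mu>)"
    if "\<mu> \<in> space (prob_algebra M)" "S \<in> sets M" for \<mu> t S
    using that by (intro markov_chain_law.prob_X[OF law])
  have T: "T \<in> Pr \<mu> \<rightarrow>\<^sub>M count_space UNIV" if "\<mu> \<in> space (prob_algebra M)" for \<mu>
    using strong that by (simp add: strong_random_time_def randomized_stopping_time_def)
  have ps: "prob_space (Pr \<mu>)" if "\<mu> \<in> space (prob_algebra M)" for \<mu>
    using prob[OF that] by (simp add: space_prob_algebra)
  have sums: "?p \<mu> sums 1" if "\<mu> \<in> space (prob_algebra M)" for \<mu>
    using prob_space.random_time_tail(3)[OF ps T, OF that that] finite_time[OF that] by simp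
  have p_0: "?p \<mu> 0 = 1 - ?G \<mu> 0" and p_Suc: "?p \<mu> (Suc n) = ?G \<mu> n - ?G \<mu> (Suc n)"
    if "\<mu> \<in> space (prob_algebra M)" for \<mu> n
    using prob_space.random_time_tail(1,2)[OF ps T, OF that that] by auto
  have "enat 0 < s \<longleftrightarrow> 1 \<le> s" for s by (cases s) (auto simp: one_enat_def)
  then have G_0: "?G \<nu> 0 = 1" using ge1 by simp
  have A\<nu>: "0 \<le> A\<nu>" using tail_nu[of 0] G_0 by simp
  have geometric: "(\<lambda>n. A\<nu> * \<rho> ^ n) sums (A\<nu> * (1 / (1 - \<rho>)))"
    using rho by (intro sums_mult geometric_sums) auto
  then have G_summable: "summable (?G \<nu>)"
    using tail_nu by (intro summable_comparison_test'[OF sums_summable]) auto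
  define m where "m = suminf (?G \<nu>)"
  have G_sums: "?G \<nu> sums m" unfolding m_def using G_summable by (rule summable_sums)
  have v_nonneg: "0 \<le> ?v t S" if "S \<in> sets M" for t S
    using prob_X[OF \<nu> that, of t] by (metis measure_nonneg)
  have stationary: "\<P>(\<omega> in Pr \<pi>. X t \<omega> \<in> S) = measure \<pi> S" if "S \<in> sets M" for t S
    using that sets.sets_into_space[OF that]
    by (simp add: prob_X[OF pi] R.integral_kernel_iter bounded_measurable_indicator R.pi_space Int_absorb2)
  have dom: "(\<Sum>k\<le>j. ?G \<nu> k * ?v (j - k) S) \<le> m * measure \<pi> S" if S: "S \<in> sets M" for j S
  proof (rule renewal_sum_le[where q = "?p \<nu>" and p = "?p \<pi>"])
    \<comment> \<open>Both inequalities drop the part of the chain on which \<open>T > t\<close>.\<close>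
    show "(\<Sum>n\<le>t. ?p \<nu> n * ?v (t - n) S) \<le> ?v t S" for t
      using decomposition[OF \<nu> S, of t] prob_X[OF \<nu> S, of t] measure_nonneg[of "Pr \<nu>"] by simp
    show "(\<Sum>n\<le>t. ?p \<pi> n * ?v (t - n) S) \<le> measure \<pi> S" for t
      using decomposition[OF pi S, of t] stationary[OF S, of t] measure_nonneg[of "Pr \<pi>"] by simp
  qed (use v_nonneg[OF S] sums[OF pi] G_sums G_0 p_0[OF \<nu>] p_Suc[OF \<nu>] in auto)
  have v_bound: "\<bar>?v t S - measure \<pi> S\<bar> \<le> D * \<rho> ^ t" if S: "S \<in> sets M" for t S
  proof -
    \<comment> \<open>The geometric tail beyond \<open>2t\<close> has \<open>\<rho>\<^bsup>2t+1\<^esup>\<close> in front, whose root is the source of \<open>\<rho>\<^sup>t\<close> and of the \<open>\<rho>\<close> in \<open>D\<close>.\<close>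
    have "m - (\<Sum>k\<le>2 * t. ?G \<nu> k) = (\<Sum>k. ?G \<nu> (k + Suc (2 * t)))"
      unfolding m_def using suminf_split_initial_segment[OF G_summable, of "Suc (2 * t)"]
      by (simp add: lessThan_Suc_atMost)
    also have "\<dots> \<le> (\<Sum>k. A\<nu> * \<rho> ^ (k + Suc (2 * t)))"
      using tail_nu G_summable sums_summable[OF geometric]
      by (intro suminf_le summable_ignore_initial_segment)
    also have "\<dots> = A\<nu> * \<rho> / (1 - \<rho>) * (\<rho> ^ t)\<^sup>2"
      using sums_unique[OF sums_mult2[OF geometric, of "\<rho> ^ Suc (2 * t)"]]
      by (simp add: power_add mult_ac power_mult[symmetric] flip: power_mult)
    finally have "sqrt (m - (\<Sum>k\<le>2 * t. ?G \<nu> k)) \<le> sqrt (A\<nu> * \<rho> / (1 - \<rho>) * (\<rho> ^ t)\<^sup>2)"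
      by (rule real_sqrt_le_mono)
    also have "\<dots> = sqrt (A\<nu> * \<rho> / (1 - \<rho>)) * \<rho> ^ t"
      using rho by (simp only: real_sqrt_mult real_sqrt_abs) simp
    finally have "1 / 2 * sqrt (m - (\<Sum>k\<le>2 * t. ?G \<nu> k)) \<le> D * \<rho> ^ t" by (simp add: D)
    moreover have "(\<Sum>k\<le>n. ?G \<nu> k) \<le> m" for n
      unfolding m_def using G_summable by (intro sum_le_suminf) auto
    ultimately show ?thesis
      using R.total_variation_from_dominating_sums[where G = "?G \<nu>" and m = m and t = t, OF nonneg \<nu> _ G_0 _ dom S]
      by fastforce
  qed
  have D_nonneg: "0 \<le> D" using A\<nu> rho by (simp add: D)
  interpret N: markov_chain_law M P "Pr (return M x)" "return M x" X using \<delta> by (rule law)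
  note [measurable] = T[OF \<delta>]
  show "tv_dist (distr (Pr (return M x)) M (X t)) \<pi> \<le> F t * \<rho> ^ t"
    unfolding tv_dist_def
  proof (rule cSUP_least)
    fix S assume "S \<in> sets (distr (Pr (return M x)) M (X t))"
    then have S [measurable]: "S \<in> sets M" by simp
    have "measure (distr (Pr (return M x)) M (X t)) S = \<P>(\<omega> in Pr (return M x). X t \<omega> \<in> S)"
      by (subst measure_distr) (auto intro!: arg_cong[where f = "measure _"])
    also have "\<dots> = ?e (return M x) t S + (\<Sum>n\<le>t. ?p (return M x) n * ?v (t - n) S)"
      using \<delta> S by (rule decomposition)
    finally have eq: "measure (distr (Pr (return M x)) M (X t)) S - measure \<pi> S
        = ?e (return M x) t S + (\<Sum>n\<le>t. ?p (return M x) n * ?v (t - n) S) - measure \<pi> S" by simp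
    show "\<bar>measure (distr (Pr (return M x)) M (X t)) S - measure \<pi> S\<bar> \<le> F t * \<rho> ^ t"
      unfolding eq F
    proof (rule convolution_geometric_bound[OF rho])
      show "?e (return M x) t S \<le> ?G (return M x) t"
        by (intro N.finite_measure_mono) auto
      show "measure \<pi> S \<le> 1" using R.pi_prob by (rule prob_space.prob_le_1)
    qed (use p_0[OF \<delta>] p_Suc[OF \<delta>] tail_x D_nonneg v_bound[OF S] in auto)
  qed (use sets.top[of M] in auto)
qed

end
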